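(* Let $f:[0,1]\to[0,1]$ be defined by $f(\alpha)=\min(3\alpha/2,(1+\alpha)/2)$ and $\mathcal{U}=\{(\alpha_1,\alpha_2)\in[0,1]^2:\alpha_2\geq f(\alpha_1)\}$. Then $$\{(\overline{d}(A),\overline{d}(2A)) : A\subset\mathbb{N},\ \gcd(A-A)=1\}=\mathcal{U}.$$
   Context: For $A\subset\mathbb{N}$, $2A=\{a+b:a,b\in A\}$, $A-A=\{a-b:a,b\in A\}$, and $\gcd(A-A)=1$ means the greatest common divisor of the elements of $A-A$ is $1$ (equivalently $A$ is not contained in an arithmetic progression of common difference at least $2$). $\overline{d}(A)=\limsup_{N\to\infty}|A\cap\{1,\dots,N\}|/N$. *)

theory Defs
  imports Complex_Main "HOL-Library.Extended_Real" "HOL-Library.Liminf_Limsup" "HOL-Library.Set_Algebras"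
begin

text \<open>The limit superior is taken in the extended reals, where it always exists; the
  lemma \<open>ereal_upper_density\<close> below shows that converting back to a real loses nothing.
  The value of the quotient at \<open>N = 0\<close> is irrelevant.\<close>

definition upper_density :: "nat set \<Rightarrow> real" where
  "upper_density A =
     real_of_ereal (limsup (\<lambda>N::nat. ereal (real (card (A \<inter> {1..N})) / real N)))"

definition diffset :: "nat set \<Rightarrow> int set" where
  "diffset A = {int a - int b | a b. a \<in> A \<and> b \<in> A}"

definition f_min :: "real \<Rightarrow> real" where
  "f_min \<alpha> = min (3 * \<alpha> / 2) ((1 + \<alpha>) / 2)"

definition \<U> :: "(real \<times> real) set" where
  "\<U> = {(\<alpha>\<^sub>1, \<alpha>\<^sub>2). \<alpha>\<^sub>1 \<in> {0..1} \<and> \<alpha>\<^sub>2 \<in> {0..1} \<and> \<alpha>\<^sub>2 \<ge> f_min \<alpha>\<^sub>1}"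

lemma ereal_upper_density:
  "ereal (upper_density A) = limsup (\<lambda>N::nat. ereal (real (card (A \<inter> {1..N})) / real N))"
    (is "_ = limsup ?q")
proof -
  have le: "card (A \<inter> {1..N}) \<le> N" for N :: nat
    using card_mono[of "{1..N}" "A \<inter> {1..N}"] by simp
  have q: "0 \<le> ?q N" "?q N \<le> 1" for N
    using le[of N] by (auto simp: divide_le_eq_1 one_ereal_def)
  have "limsup ?q \<le> 1"
    by (rule Limsup_bounded) (use q in simp)
  moreover have "0 \<le> limsup ?q"
    by (rule le_Limsup) (use q in simp_all)
  ultimately show ?thesis
    unfolding upper_density_def by (cases "limsup ?q") auto
qed

end

theory Submission
  imports Defs
begin

text \<open>
  Lower bound: let \<open>A\<close> contain \<open>k\<close> elements of \<open>[0, N]\<close>, among them \<open>0\<close> and \<open>N\<close>, with coprime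
  differences. Freiman's theorem gives \<open>min (3k - 3) (k + N)\<close> elements of \<open>2A\<close> in \<open>[0, 2N]\<close>;
  dividing by \<open>2N\<close> along a sequence of \<open>N \<in> A\<close> that realises the upper density yields
  \<open>f (\<alpha>)\<close>. For \<open>N \<le> 2k - 3\<close> Freiman's bound is a pigeonhole argument modulo \<open>N\<close>; for
  \<open>N \<ge> 2k - 2\<close> it is proved by induction, cutting \<open>A\<close> at an element where both parts
  remain sparse.

  Sharpness: at very rapidly growing scales \<open>N\<close>, take the interval \<open>[(1 - \<alpha>) N, N]\<close> together with
  a set of negligible size whose sumset is essentially \<open>[2 (1 - \<gamma>) N, 2 N]\<close>. Smaller scales
  contribute a copy of \<open>[(1 - \<alpha>) N, N]\<close> to the sumset, and \<open>\<gamma>\<close> adjusts its density up to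
  \<open>2 N\<close> to any value between \<open>f (\<alpha>)\<close> and \<open>1\<close>.
\<close>

section \<open>Sumsets of integers cut in two\<close>

text \<open>The obstacle is the sparse half of Freiman's theorem. Parts \<open>B\<close> and
  \<open>C\<close> cut at \<open>c\<close> share \<open>c\<close>, and their sumsets share
  \<open>2 * c\<close>, so two bounds of the form \<open>3 * k - 3\<close> add up to
  \<open>3 * card A - 4\<close>, one short. The missing sum has to be mixed, with one summand from
  each part. If a part has a common divisor of its differences, residues modulo that divisor supply
  mixed sums; if both parts are primitive, the lack of a new mixed sum is so rigid that moving the
  cut by one step gains the missing sum. In the construction, the copy of
  \<open>[(1 - \<alpha>) N, N]\<close> inside the sumset explains the two branches of
  \<open>f\<close>. While it is disjoint from \<open>[2 (1 - \<gamma>) N, 2 N]\<close>, the density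
  up to \<open>2 N\<close> is \<open>\<gamma> + \<alpha> / 2\<close>, and \<gamma> running from
  \<alpha> to \<open>1 / 2\<close> covers \<open>3 \<alpha> / 2\<close> to
  \<open>(1 + \<alpha>) / 2\<close>. Once \<open>\<gamma> \<ge> (1 + \<alpha>) / 2\<close> the copy
  is swallowed and the density is \<gamma>.\<close>

definition coprime_diffs :: "int set \<Rightarrow> bool" where
  "coprime_diffs A \<longleftrightarrow> (\<forall>d. (\<forall>x\<in>A. \<forall>y\<in>A. d dvd x - y) \<longrightarrow> d dvd 1)"

lemma coprime_diffsD:
  "\<lbrakk>coprime_diffs A; \<And>x y. \<lbrakk>x \<in> A; y \<in> A\<rbrakk> \<Longrightarrow> d dvd x - y\<rbrakk> \<Longrightarrow> d dvd 1"
  unfolding coprime_diffs_def by blast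

lemma coprime_diffs_witness:
  assumes "coprime_diffs A" "\<not> d dvd 1" "c \<in> A"
  obtains y where "y \<in> A" "\<not> d dvd y - c"
proof -
  have "\<exists>y\<in>A. \<not> d dvd y - c"
  proof (rule ccontr)
    assume H: "\<not> (\<exists>y\<in>A. \<not> d dvd y - c)"
    have "d dvd x - y" if "x \<in> A" "y \<in> A" for x y
      using H that dvd_diff[of d "x - c" "y - c"] by auto
    then show False
      using assms coprime_diffsD by blast
  qed
  then show ?thesis using that by blast
qed

lemma not_coprime_diffsE:
  assumes "\<not> coprime_diffs A"
  obtains d where "\<not> d dvd 1" "\<And>x y. \<lbrakk>x \<in> A; y \<in> A\<rbrakk> \<Longrightarrow> d dvd x - y"
  using assms unfolding coprime_diffs_def by blast

section \<open>Invariance under reflection and translation\<close>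

lemma coprime_diffs_uminus: "coprime_diffs (uminus ` A) = coprime_diffs A"
proof -
  have "d dvd - x - - y \<longleftrightarrow> d dvd x - y" for d x y :: int
    using dvd_minus_iff[of d "x - y"] by (simp add: algebra_simps)
  then show ?thesis
    unfolding coprime_diffs_def by (simp only: ball_simps)
qed

lemma uminus_sumset: "uminus ` X + uminus ` Y = uminus ` (X + Y :: int set)"
proof (intro equalityI subsetI)
  fix z assume "z \<in> uminus ` X + uminus ` Y"
  then obtain a b where "a \<in> X" "b \<in> Y" "z = - a + - b"
    by (auto elim!: set_plus_elim)
  then show "z \<in> uminus ` (X + Y)"
    by (intro image_eqI[of _ _ "a + b"]) (auto intro: set_plus_intro)
next
  fix z assume "z \<in> uminus ` (X + Y)"
  then obtain a b where "a \<in> X" "b \<in> Y" "z = - a + - b"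
    by (auto elim!: set_plus_elim)
  then show "z \<in> uminus ` X + uminus ` Y"
    by (metis imageI set_plus_intro)
qed

lemma card_uminus: "card (uminus ` A) = card (A :: int set)"
  by (simp add: card_image)

lemma card_sumset_uminus: "card (uminus ` A + uminus ` A) = card (A + A :: int set)"
  unfolding uminus_sumset by (rule card_uminus)

lemma translate_sumset:
  "(\<lambda>x. x - l) ` A + (\<lambda>x. x - l) ` A = (\<lambda>x. x - 2 * l) ` (A + A :: int set)"
proof (intro equalityI subsetI)
  fix z assume "z \<in> (\<lambda>x. x - l) ` A + (\<lambda>x. x - l) ` A"
  then obtain a b where "a \<in> A" "b \<in> A" "z = (a - l) + (b - l)"
    by (auto elim!: set_plus_elim)
  then show "z \<in> (\<lambda>x. x - 2 * l) ` (A + A)"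
    by (intro image_eqI[of _ _ "a + b"]) (auto intro: set_plus_intro)
next
  fix z assume "z \<in> (\<lambda>x. x - 2 * l) ` (A + A)"
  then obtain a b where "a \<in> A" "b \<in> A" "z = (a - l) + (b - l)"
    by (auto elim!: set_plus_elim)
  then show "z \<in> (\<lambda>x. x - l) ` A + (\<lambda>x. x - l) ` A"
    by (metis (no_types, lifting) imageI set_plus_intro)
qed

lemma card_sumset_translate:
  "card ((\<lambda>x. x - l) ` A + (\<lambda>x. x - l) ` A) = card (A + A :: int set)"
  unfolding translate_sumset by (simp add: card_image inj_on_def)

lemma coprime_diffs_translate: "coprime_diffs ((\<lambda>x. x - l) ` A) = coprime_diffs A"
  unfolding coprime_diffs_def by simp

text \<open>Two chains climb through the sumset: \<open>X\<close> shifted by the least element of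
  \<open>Y\<close>, then \<open>Y\<close> shifted by the greatest element of \<open>X\<close>. They
  meet only in \<open>Max X + Min Y\<close>.\<close>

lemma card_sumset_ge:
  fixes X Y :: "int set"
  assumes "finite X" "finite Y" "X \<noteq> {}" "Y \<noteq> {}"
  shows "card X + card Y \<le> card (X + Y) + 1"
proof -
  define P where "P = (\<lambda>x. x + Min Y) ` X"
  define Q where "Q = (\<lambda>y. Max X + y) ` Y"
  have "P \<inter> Q \<subseteq> {Max X + Min Y}"
  proof
    fix z assume "z \<in> P \<inter> Q"
    then obtain x y where "x \<in> X" "y \<in> Y" "z = x + Min Y" "z = Max X + y"
      by (auto simp: P_def Q_def)
    moreover have "x \<le> Max X" "Min Y \<le> y"
      using calculation assms by auto
    ultimately show "z \<in> {Max X + Min Y}" by simp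
  qed
  then have "card (P \<inter> Q) \<le> 1"
    using card_mono[of "{Max X + Min Y}" "P \<inter> Q"] by simp
  moreover have "card P = card X" "card Q = card Y"
    by (simp_all add: P_def Q_def card_image)
  moreover have "card P + card Q = card (P \<union> Q) + card (P \<inter> Q)"
    using assms by (intro card_Un_Int) (auto simp: P_def Q_def)
  moreover have "P \<union> Q \<subseteq> X + Y"
    using Min_in[OF assms(2,4)] Max_in[OF assms(1,3)]
    by (auto simp: P_def Q_def simp del: Min_in Max_in intro!: set_plus_intro)
  then have "card (P \<union> Q) \<le> card (X + Y)"
    using assms by (intro card_mono finite_set_plus)
  ultimately show ?thesis by linarith
qed

section \<open>Sets cut at one of their elements\<close>

lemma cut_card:
  fixes A :: "int set"
  assumes "finite A" "c \<in> A"
  shows "card (A \<inter> {..c}) + card (A \<inter> {c..}) = card A + 1"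
proof -
  have "(A \<inter> {..c}) \<union> (A \<inter> {c..}) = A" "(A \<inter> {..c}) \<inter> (A \<inter> {c..}) = {c}"
    using assms by auto
  then show ?thesis
    using card_Un_Int[of "A \<inter> {..c}" "A \<inter> {c..}"] assms by simp
qed

text \<open>Sums of the lower part are at most \<open>2 * c\<close>, those of the upper part at
  least \<open>2 * c\<close>; the single possible overlap is the \<open>+ 1\<close>. The set
  \<open>Z\<close> is meant for mixed sums.\<close>

lemma cut_sumset:
  fixes A :: "int set"
  assumes "finite A" "c \<in> A"
    and "Z \<subseteq> A + A" "Z \<inter> (A \<inter> {..c} + A \<inter> {..c}) = {}" "Z \<inter> (A \<inter> {c..} + A \<inter> {c..}) = {}"
  shows "card (A \<inter> {..c} + A \<inter> {..c}) + card (A \<inter> {c..} + A \<inter> {c..}) + card Z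
    \<le> card (A + A) + 1"
proof -
  let ?P = "A \<inter> {..c} + A \<inter> {..c}" and ?Q = "A \<inter> {c..} + A \<inter> {c..}"
  have fin: "finite ?P" "finite ?Q" "finite (A + A)" "finite Z"
    using assms finite_subset[OF assms(3)] by (auto intro!: finite_set_plus)
  have "x = 2 * c" if "x \<in> ?P" "x \<in> ?Q" for x
  proof (rule antisym)
    show "x \<le> 2 * c" using that(1) by (auto elim!: set_plus_elim)
    show "2 * c \<le> x" using that(2) by (auto elim!: set_plus_elim)
  qed
  then have "?P \<inter> ?Q \<subseteq> {2 * c}"
    by (simp add: subset_iff)
  then have "card (?P \<inter> ?Q) \<le> 1"
    using card_mono[of "{2 * c}" "?P \<inter> ?Q"] by simp
  moreover have "card ?P + card ?Q = card (?P \<union> ?Q) + card (?P \<inter> ?Q)"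
    using fin by (intro card_Un_Int)
  moreover have "card (?P \<union> ?Q \<union> Z) = card (?P \<union> ?Q) + card Z"
    using fin assms by (intro card_Un_disjoint) auto
  moreover have "?P \<union> ?Q \<union> Z \<subseteq> A + A"
    using assms(3) set_plus_mono2[of "A \<inter> {..c}" A "A \<inter> {..c}" A]
      set_plus_mono2[of "A \<inter> {c..}" A "A \<inter> {c..}" A] by blast
  then have "card (?P \<union> ?Q \<union> Z) \<le> card (A + A)"
    using fin by (intro card_mono)
  ultimately show ?thesis by linarith
qed

text \<open>Modulo a common divisor \<open>d\<close>, the left part \<open>?B\<close> stays in the
  class of \<open>c\<close>. Let \<open>y\<close> be the least element of \<open>A\<close> outside
  that class. The sums \<open>x + y\<close> with \<open>x < c\<close> miss the class of
  \<open>2 * c\<close>, hence miss \<open>?B + ?B\<close>. They also lie below \<open>y + c\<close>,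
  where a sum of two elements of \<open>?C\<close> uses only elements before \<open>y\<close> and so
  stays in the class of \<open>2 * c\<close>. These \<open>card ?B - 1\<close> mixed sums lift the
  trivial bound \<open>2 * card ?B - 1\<close> to \<open>3 * card ?B - 2\<close>, which also pays
  for the shared point \<open>2 * c\<close>.\<close>

lemma cut_left_imprimitive:
  fixes A :: "int set"
  assumes A: "finite A" "c \<in> A" "coprime_diffs A"
    and nc: "\<not> coprime_diffs (A \<inter> {..c})"
    and Q: "3 * int (card (A \<inter> {c..})) - 3 \<le> int (card (A \<inter> {c..} + A \<inter> {c..}))"
  shows "3 * int (card A) - 3 \<le> int (card (A + A))"
proof -
  let ?B = "A \<inter> {..c}" and ?C = "A \<inter> {c..}"
  obtain d where d: "\<not> d dvd 1" "\<And>x y. \<lbrakk>x \<in> ?B; y \<in> ?B\<rbrakk> \<Longrightarrow> d dvd x - y"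
    using nc by (rule not_coprime_diffsE) blast
  define Y where "Y = {y \<in> A. \<not> d dvd y - c}"
  have finY: "finite Y" using A by (simp add: Y_def)
  have "Y \<noteq> {}"
    using coprime_diffs_witness[OF A(3) d(1) A(2)] by (auto simp: Y_def)
  define y where "y = Min Y"
  have y: "y \<in> A" "\<not> d dvd y - c"
    using Min_in[OF finY \<open>Y \<noteq> {}\<close>] by (auto simp: Y_def y_def)
  have below: "d dvd z - c" if "z \<in> A" "z < y" for z
    using that Min_le[OF finY, of z] by (force simp: Y_def y_def)
  have "c < y"
    using y d(2)[of y c] A(2) by (cases "y \<le> c") auto
  define Z where "Z = (\<lambda>x. x + y) ` (?B - {c})"
  have cZ: "int (card Z) = int (card ?B) - 1"
    using A card_gt_0_iff[of ?B] by (auto simp: Z_def card_image of_nat_diff Suc_le_eq)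
  have Zmod: "\<not> d dvd z - 2 * c" "z < y + c" if "z \<in> Z" for z
  proof -
    from that obtain x where x: "x \<in> ?B" "x \<noteq> c" "z = x + y"
      unfolding Z_def by blast
    have "d dvd x - c" using d(2)[OF x(1)] A(2) by simp
    moreover have "z - 2 * c = (x - c) + (y - c)" using x(3) by simp
    ultimately show "\<not> d dvd z - 2 * c"
      using y(2) dvd_add_right_iff[of d "x - c" "y - c"] by metis
    show "z < y + c" using x by auto
  qed
  have "Z \<subseteq> A + A"
    using y(1) by (auto simp: Z_def intro!: set_plus_intro)
  moreover have "Z \<inter> (?B + ?B) = {}"
  proof -
    have False if "z \<in> Z" "z \<in> ?B + ?B" for z
    proof -
      from that(2) obtain a b where "a \<in> ?B" "b \<in> ?B" "z = a + b"
        by (auto elim!: set_plus_elim)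
      then have "d dvd (a - c) + (b - c)"
        using d(2) A(2) by (intro dvd_add) auto
      moreover have "(a - c) + (b - c) = z - 2 * c" using \<open>z = a + b\<close> by simp
      ultimately show False using Zmod(1)[OF that(1)] by metis
    qed
    then show ?thesis by blast
  qed
  moreover have "Z \<inter> (?C + ?C) = {}"
  proof -
    have False if "z \<in> Z" "z \<in> ?C + ?C" for z
    proof -
      from that(2) obtain a b where ab: "a \<in> ?C" "b \<in> ?C" "z = a + b"
        by (auto elim!: set_plus_elim)
      then have "a < y" "b < y" using Zmod(2)[OF that(1)] by auto
      then have "d dvd (a - c) + (b - c)"
        using below ab by (intro dvd_add) auto
      moreover have "(a - c) + (b - c) = z - 2 * c" using \<open>z = a + b\<close> by simp
      ultimately show False using Zmod(1)[OF that(1)] by metis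
    qed
    then show ?thesis by blast
  qed
  ultimately have "card (?B + ?B) + card (?C + ?C) + card Z \<le> card (A + A) + 1"
    by (rule cut_sumset[OF A(1,2)])
  moreover have "?B \<noteq> {}" using A(2) by auto
  then have "2 * card ?B \<le> card (?B + ?B) + 1"
    using card_sumset_ge[of ?B ?B] A(1) by simp
  moreover have "card ?B + card ?C = card A + 1"
    by (rule cut_card[OF A(1,2)])
  ultimately show ?thesis using Q cZ by linarith
qed

lemma uminus_Int_atMost: "uminus ` A \<inter> {..- c} = uminus ` (A \<inter> {c :: int..})"
  by auto

lemma uminus_Int_atLeast: "uminus ` A \<inter> {- c..} = uminus ` (A \<inter> {..c :: int})"
  by auto

lemma cut_right_imprimitive:
  fixes A :: "int set"
  assumes A: "finite A" "c \<in> A" "coprime_diffs A"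
    and nc: "\<not> coprime_diffs (A \<inter> {c..})"
    and Q: "3 * int (card (A \<inter> {..c})) - 3 \<le> int (card (A \<inter> {..c} + A \<inter> {..c}))"
  shows "3 * int (card A) - 3 \<le> int (card (A + A))"
proof -
  have "3 * int (card (uminus ` A)) - 3 \<le> int (card (uminus ` A + uminus ` A))"
  proof (rule cut_left_imprimitive)
    show "finite (uminus ` A)" "- c \<in> uminus ` A" "coprime_diffs (uminus ` A)"
      using A by (simp_all add: coprime_diffs_uminus)
    show "\<not> coprime_diffs (uminus ` A \<inter> {..- c})"
      using nc unfolding uminus_Int_atMost coprime_diffs_uminus .
    show "3 * int (card (uminus ` A \<inter> {- c..})) - 3
      \<le> int (card (uminus ` A \<inter> {- c..} + uminus ` A \<inter> {- c..}))"
      using Q unfolding uminus_Int_atLeast card_uminus card_sumset_uminus .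
  qed
  then show ?thesis unfolding card_uminus card_sumset_uminus .
qed

section \<open>Counting residues\<close>

text \<open>Serves the critical case twice: for the periods of \<open>A\<close> modulo
  \<open>N\<close>, and for \<open>A\<close> modulo \<open>N\<close> itself when it is supposed to
  be closed under addition.\<close>

lemma int_subgroup_generator:
  fixes H :: "int set"
  assumes "h \<in> H" "h > 0" and diff: "\<And>x y. \<lbrakk>x \<in> H; y \<in> H\<rbrakk> \<Longrightarrow> x - y \<in> H"
  obtains d where "d > 0" "\<And>x. x \<in> H \<longleftrightarrow> d dvd x"
proof -
  define P where "P = (\<lambda>n::nat. 0 < n \<and> int n \<in> H)"
  define d where "d = int (LEAST n. P n)"
  have "P (nat h)" using assms(1,2) by (simp add: P_def)
  then have "P (LEAST n. P n)" by (rule LeastI)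
  then have d: "d > 0" "d \<in> H" by (simp_all add: P_def d_def)
  have zero: "0 \<in> H" using diff[OF assms(1,1)] by simp
  have nat_mult: "int n * d \<in> H" for n
  proof (induction n)
    case (Suc n)
    have "int n * d - (0 - d) \<in> H" using diff Suc zero d(2) by blast
    then show ?case by (simp add: algebra_simps)
  qed (simp add: zero)
  have mult: "k * d \<in> H" for k
  proof (cases "k \<ge> 0")
    case True
    then show ?thesis using nat_mult[of "nat k"] by simp
  next
    case False
    then show ?thesis using diff[OF zero nat_mult[of "nat (- k)"]] by simp
  qed
  have "d dvd x" if "x \<in> H" for x
  proof (rule ccontr)
    assume "\<not> d dvd x"
    then have "x mod d > 0"
      using d(1) by (simp add: dvd_eq_mod_eq_0 order_le_neq_trans)
    moreover have "x mod d \<in> H"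
      using diff[OF that mult[of "x div d"]] by (simp add: minus_div_mult_eq_mod)
    ultimately have "P (nat (x mod d))" by (simp add: P_def)
    then have "d \<le> x mod d"
      unfolding d_def using Least_le[of P] \<open>x mod d > 0\<close>
      by (metis d_def int_nat_eq less_imp_le of_nat_mono)
    then show False using d(1) pos_mod_bound[of d x] by linarith
  qed
  moreover have "x \<in> H" if "d dvd x" for x
    using that mult by (metis dvd_def mult.commute)
  ultimately show ?thesis using that d(1) by blast
qed

text \<open>A residue modulo \<open>N\<close> is represented in \<open>A + A\<close> by \<open>r\<close> or by \<open>r + N\<close>, and by both of them
  when \<open>r \<in> A\<close>, because \<open>0, N \<in> A\<close>.\<close>

lemma card_sumset_residues:
  fixes A :: "int set"
  assumes A: "A \<subseteq> {0..N}" "0 \<in> A" "N \<in> A" "0 < N"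
    and X: "X = {r \<in> {0..<N}. r \<notin> A + A \<and> r + N \<notin> A + A}"
    and Y: "Y \<subseteq> {0..<N} - A" "\<And>r. r \<in> Y \<Longrightarrow> r \<in> A + A \<and> r + N \<in> A + A"
  shows "N - int (card X) + int (card A) + int (card Y) \<le> int (card (A + A))"
proof -
  define P where "P = {r \<in> {0..<N}. r \<in> A + A}"
  define Q where "Q = {r \<in> {0..<N}. r + N \<in> A + A}"
  have finA: "finite A" using A(1) finite_subset by blast
  have "P \<subseteq> {0..<N}" "Q \<subseteq> {0..<N}" "X \<subseteq> {0..<N}" "Y \<subseteq> {0..<N}"
    using Y(1) by (auto simp: P_def Q_def X)
  then have fin: "finite P" "finite Q" "finite X" "finite Y"
    by (auto dest: finite_subset)
  have "P \<union> Q = {0..<N} - X" by (auto simp: P_def Q_def X)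
  moreover have "card ({0..<N} - X) = card {0..<N} - card X"
    using fin \<open>X \<subseteq> {0..<N}\<close> by (intro card_Diff_subset)
  moreover have "card X \<le> card {0..<N}"
    using \<open>X \<subseteq> {0..<N}\<close> by (intro card_mono) auto
  ultimately have 1: "int (card (P \<union> Q)) = N - int (card X)"
    using A(4) by (simp add: of_nat_diff)
  have "(A - {N}) \<union> Y \<subseteq> P \<inter> Q"
  proof -
    have "a \<in> A + A" "a + N \<in> A + A" if "a \<in> A" for a
      using set_plus_intro[OF that A(2)] set_plus_intro[OF that A(3)] by auto
    moreover have "0 \<le> a \<and> a < N" if "a \<in> A" "a \<noteq> N" for a
      using that A(1) by force
    ultimately show ?thesis
      using Y by (auto simp: P_def Q_def)
  qed
  then have "card ((A - {N}) \<union> Y) \<le> card (P \<inter> Q)"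
    using fin by (intro card_mono) auto
  moreover have "card ((A - {N}) \<union> Y) = card (A - {N}) + card Y"
    using Y(1) fin finA by (intro card_Un_disjoint) auto
  moreover have "card A = Suc (card (A - {N}))"
    by (rule card.remove[OF finA A(3)])
  ultimately have 2: "card A + card Y \<le> card (P \<inter> Q) + 1" by linarith
  have 3: "card P + card Q = card (P \<union> Q) + card (P \<inter> Q)"
    using fin by (intro card_Un_Int)
  have "N + N \<in> A + A" using A(3) by (intro set_plus_intro)
  then have sub: "insert (N + N) (P \<union> (\<lambda>r. r + N) ` Q) \<subseteq> A + A"
    by (auto simp: P_def Q_def)
  have "card (insert (N + N) (P \<union> (\<lambda>r. r + N) ` Q)) = Suc (card (P \<union> (\<lambda>r. r + N) ` Q))"
    using fin A(4) by (intro card_insert_disjoint) (auto simp: P_def Q_def)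
  moreover have "card (P \<union> (\<lambda>r. r + N) ` Q) = card P + card ((\<lambda>r. r + N) ` Q)"
    using fin by (intro card_Un_disjoint) (auto simp: P_def Q_def)
  moreover have "card ((\<lambda>r. r + N) ` Q) = card Q"
    by (simp add: card_image)
  moreover have "card (insert (N + N) (P \<union> (\<lambda>r. r + N) ` Q)) \<le> card (A + A)"
    using sub finA by (intro card_mono finite_set_plus)
  ultimately show ?thesis using 1 2 3 by linarith
qed

text \<open>If \<open>a + b\<close> were congruent to \<open>r\<close>, it would equal
  \<open>r\<close> or \<open>r + N\<close>, since it lies in \<open>[0, 2 N)\<close>. The element
  \<open>N\<close> is left out because it repeats the residue of \<open>0\<close>; so
  \<open>A\<close> and its reflection compete for the \<open>N\<close> residues.\<close>

lemma missing_residue_disjoint: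
  fixes A :: "int set"
  assumes A: "A \<subseteq> {0..N}" "0 < N"
    and r: "0 \<le> r" "r < N" "r \<notin> A + A" "r + N \<notin> A + A"
  shows "(A - {N}) \<inter> (\<lambda>a. (r - a) mod N) ` (A - {N}) = {}"
    and "card ((\<lambda>a. (r - a) mod N) ` (A - {N})) = card (A - {N})"
proof -
  have rng: "0 \<le> a \<and> a < N" if "a \<in> A - {N}" for a using that A(1) by force
  show "(A - {N}) \<inter> (\<lambda>a. (r - a) mod N) ` (A - {N}) = {}"
  proof (rule ccontr)
    assume "(A - {N}) \<inter> (\<lambda>a. (r - a) mod N) ` (A - {N}) \<noteq> {}"
    then obtain a b where ab: "a \<in> A - {N}" "b \<in> A - {N}" "b = (r - a) mod N" by blast
    have "(a + b) mod N = r"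
      using r by (simp add: ab(3) mod_add_right_eq)
    then have "a + b = r \<or> a + b = r + N"
      using rng[OF ab(1)] rng[OF ab(2)] A(2)
      by (smt (verit) mod_add_self2 mod_pos_pos_trivial minus_mod_self2)
    moreover have "a + b \<in> A + A" using ab by (intro set_plus_intro) auto
    ultimately show False using r by auto
  qed
  have "inj_on (\<lambda>a. (r - a) mod N) (A - {N})"
  proof (rule inj_onI)
    fix a b assume ab: "a \<in> A - {N}" "b \<in> A - {N}" "(r - a) mod N = (r - b) mod N"
    then have "N dvd (r - a) - (r - b)" by (simp only: mod_eq_dvd_iff)
    then have "N dvd b - a" by simp
    then show "a = b"
      using rng[OF ab(1)] rng[OF ab(2)] dvd_imp_le_int[of "b - a" N] by fastforce
  qed
  then show "card ((\<lambda>a. (r - a) mod N) ` (A - {N})) = card (A - {N})"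
    by (rule card_image)
qed

text \<open>A missing residue would put two disjoint sets of \<open>card A - 1\<close> elements
  among \<open>N\<close> residues, which requires \<open>2 * card A - 2 \<le> N\<close>.\<close>

lemma card_sumset_dense:
  fixes A :: "int set"
  assumes A: "A \<subseteq> {0..N}" "0 \<in> A" "N \<in> A" "0 < N" and dense: "N \<le> 2 * int (card A) - 3"
  shows "int (card A) + N \<le> int (card (A + A))"
proof -
  define X where "X = {r \<in> {0..<N}. r \<notin> A + A \<and> r + N \<notin> A + A}"
  have finA: "finite A" using A(1) finite_subset by blast
  have "X = {}"
  proof (rule ccontr)
    assume "X \<noteq> {}"
    then obtain r where r: "0 \<le> r" "r < N" "r \<notin> A + A" "r + N \<notin> A + A" by (auto simp: X_def)
    let ?B = "(\<lambda>a. (r - a) mod N) ` (A - {N})"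
    have "card ((A - {N}) \<union> ?B) = card (A - {N}) + card ?B"
      using missing_residue_disjoint(1)[OF A(1,4) r] finA by (intro card_Un_disjoint) auto
    moreover have "x \<in> {0..<N}" if "x \<in> A - {N}" for x using that A(1) by force
    then have "(A - {N}) \<union> ?B \<subseteq> {0..<N}"
      using A(4) by (intro Un_least subsetI) auto
    then have "card ((A - {N}) \<union> ?B) \<le> card {0..<N}" by (intro card_mono) auto
    moreover have "card A = Suc (card (A - {N}))"
      by (rule card.remove[OF finA A(3)])
    moreover have "int (card {0..<N}) = N" using A(4) by simp
    ultimately show False
      using missing_residue_disjoint(2)[OF A(1,4) r] dense by linarith
  qed
  then show ?thesis
    using card_sumset_residues[OF A X_def, of "{}"] by simp
qed

text \<open>When \<open>N = 2 |A| - 2\<close>, a residue missing from \<open>A + A\<close> reflects \<open>A\<close> modulo \<open>N\<close> onto its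
  complement, so two missing residues differ by a period. If \<open>d\<close> is the least period, at most
  \<open>N / d\<close> residues are missing; on the other hand \<open>A\<close> modulo \<open>N\<close> is not closed under addition,
  and the coset of a sum outside it has \<open>N / d - 1\<close> elements that are represented twice.\<close>

lemma card_sumset_critical:
  fixes A :: "int set"
  assumes A: "A \<subseteq> {0..N}" "0 \<in> A" "N \<in> A" "0 < N"
    and crit: "N = 2 * int (card A) - 2" and cop: "coprime_diffs A"
  shows "3 * int (card A) - 3 \<le> int (card (A + A))"
proof -
  define X where "X = {r \<in> {0..<N}. r \<notin> A + A \<and> r + N \<notin> A + A}"
  define P where "P = {n. n mod N \<in> A - {N}}"
  have finA: "finite A" using A(1) finite_subset by blast
  have cA: "card A = Suc (card (A - {N}))"
    by (rule card.remove[OF finA A(3)])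
  have AP: "A \<subseteq> P"
  proof
    fix a assume a: "a \<in> A"
    show "a \<in> P"
    proof (cases "a = N")
      case True
      then show ?thesis using A(2,4) by (simp add: P_def)
    next
      case False
      then have "0 \<le> a" "a < N" using a A(1) by force+
      then show ?thesis using a by (simp add: P_def)
    qed
  qed
  have PA: "n \<in> A" if "n \<in> P" "0 \<le> n" "n < N" for n
    using that by (simp add: P_def)
  have reflect: "n \<in> P \<longleftrightarrow> r - n \<notin> P" if "r \<in> X" for r n
  proof -
    have r: "0 \<le> r" "r < N" "r \<notin> A + A" "r + N \<notin> A + A" using that by (auto simp: X_def)
    let ?B = "(\<lambda>a. (r - a) mod N) ` (A - {N})"
    have "x \<in> {0..<N}" if "x \<in> A - {N}" for x using that A(1) by force
    moreover have "?B \<subseteq> {0..<N}" using A(4) by auto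
    ultimately have sub: "(A - {N}) \<union> ?B \<subseteq> {0..<N}" by blast
    have "card ((A - {N}) \<union> ?B) = card (A - {N}) + card ?B"
      using missing_residue_disjoint(1)[OF A(1,4) r] finA by (intro card_Un_disjoint) auto
    moreover have "int (card {0..<N}) = N" using A(4) by simp
    ultimately have "card ((A - {N}) \<union> ?B) = card {0..<N}"
      using missing_residue_disjoint(2)[OF A(1,4) r] crit cA by linarith
    then have eq: "(A - {N}) \<union> ?B = {0..<N}"
      using sub by (intro card_subset_eq) auto
    have inB: "m mod N \<in> ?B \<longleftrightarrow> r - m \<in> P" for m
    proof
      assume "m mod N \<in> ?B"
      then obtain a where a: "a \<in> A - {N}" "m mod N = (r - a) mod N" by blast
      have "0 \<le> a" "a < N" using a(1) A(1) by force+
      have "(r - m) mod N = (r - (r - a)) mod N"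
        using a(2) by (metis mod_diff_right_eq)
      then show "r - m \<in> P" using a(1) \<open>0 \<le> a\<close> \<open>a < N\<close> by (simp add: P_def)
    next
      assume "r - m \<in> P"
      then have "(r - m) mod N \<in> A - {N}" by (simp add: P_def)
      moreover have "m mod N = (r - (r - m) mod N) mod N"
        by (simp add: mod_diff_right_eq)
      ultimately show "m mod N \<in> ?B" by blast
    qed
    have "n mod N \<in> {0..<N}" using A(4) by simp
    then have "n mod N \<in> A - {N} \<longleftrightarrow> n mod N \<notin> ?B"
      using eq missing_residue_disjoint(1)[OF A(1,4) r] by blast
    then show ?thesis unfolding inB by (simp add: P_def)
  qed
  define H where "H = {h. \<forall>x. x \<in> P \<longleftrightarrow> x + h \<in> P}"
  have "N \<in> H" by (simp add: H_def P_def)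
  moreover have "g - h \<in> H" if "g \<in> H" "h \<in> H" for g h
  proof -
    have "x \<in> P \<longleftrightarrow> x + (g - h) \<in> P" for x
    proof -
      have "x - h \<in> P \<longleftrightarrow> (x - h) + h \<in> P" "x - h \<in> P \<longleftrightarrow> (x - h) + g \<in> P"
        using that unfolding H_def by blast+
      then show ?thesis by (simp add: algebra_simps)
    qed
    then show ?thesis by (simp add: H_def)
  qed
  ultimately obtain d where d: "d > 0" "\<And>x. x \<in> H \<longleftrightarrow> d dvd x"
    using int_subgroup_generator[of N H] A(4) by metis
  have "d dvd N" using d(2) \<open>N \<in> H\<close> by blast
  then obtain e where e: "N = d * e" by (rule dvdE)
  then have epos: "e > 0" using A(4) d(1) by (simp add: zero_less_mult_iff)
  have XH: "d dvd r - s" if "r \<in> X" "s \<in> X" for r s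
  proof -
    have "x \<in> P \<longleftrightarrow> x + (r - s) \<in> P" for x
    proof -
      have "r - (s - x) = x + (r - s)" by simp
      then show ?thesis using reflect[OF that(2), of x] reflect[OF that(1), of "s - x"] by metis
    qed
    then have "r - s \<in> H" unfolding H_def by blast
    then show ?thesis using d(2) by blast
  qed
  have cX: "int (card X) \<le> e"
  proof -
    \<comment> \<open>All missing residues agree modulo \<open>d\<close>, so distinct ones have
      distinct quotients, of which there are only \<open>e\<close>.\<close>
    have "inj_on (\<lambda>r. r div d) X"
    proof (rule inj_onI)
      fix r s assume rs: "r \<in> X" "s \<in> X" "r div d = s div d"
      then have "r mod d = s mod d" using XH by (simp add: mod_eq_dvd_iff)
      then show "r = s" using rs(3) by (metis div_mult_mod_eq)
    qed
    moreover have "(\<lambda>r. r div d) ` X \<subseteq> {0..<e}"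
    proof (intro image_subsetI)
      fix r assume "r \<in> X"
      then have "0 \<le> r" "r < e * d" by (auto simp: X_def e mult.commute)
      moreover have "r div d * d \<le> r"
        using d(1) by (simp add: minus_mod_eq_div_mult[symmetric])
      ultimately have "r div d * d < e * d" by linarith
      then show "r div d \<in> {0..<e}"
        using d(1) \<open>0 \<le> r\<close> by (simp add: pos_imp_zdiv_nonneg_iff)
    qed
    ultimately have "card X \<le> card {0..<e}" by (intro card_inj_on_le) auto
    then show ?thesis using epos by simp
  qed
  \<comment> \<open>Otherwise \<open>P\<close> would be a subgroup, because adding
    \<open>N - 1\<close> copies of \<open>y\<close> subtracts \<open>y\<close> modulo
    \<open>N\<close>. Its generator divides all differences in \<open>A\<close>, hence is
    \<open>1\<close>, and then all \<open>N\<close> residues would lie in a set of size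
    \<open>N / 2\<close>.\<close>
  obtain a b where ab: "a \<in> P" "b \<in> P" "a + b \<notin> P"
  proof (rule ccontr)
    assume neg: "\<not> thesis"
    have add: "x + y \<in> P" if "x \<in> P" "y \<in> P" for x y
      using neg \<open>\<And>b a. \<lbrakk>a \<in> P; b \<in> P; a + b \<notin> P\<rbrakk> \<Longrightarrow> thesis\<close> that by blast
    have zero: "0 \<in> P" using AP A(2) by blast
    have mult: "int n * y \<in> P" if "y \<in> P" for n y
    proof (induction n)
      case (Suc n)
      then show ?case using add[OF that Suc] by (simp add: algebra_simps)
    qed (simp add: zero)
    have "x - y \<in> P" if "x \<in> P" "y \<in> P" for x y
    proof -
      have "x + int (nat (N - 1)) * y \<in> P" using add mult that by blast
      moreover have "x + int (nat (N - 1)) * y = (x - y) + y * N"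
        using A(4) by (simp add: algebra_simps)
      ultimately have "(x - y) + y * N \<in> P" by metis
      then show ?thesis by (simp add: P_def)
    qed
    moreover have "N \<in> P" using AP A(3) by blast
    ultimately obtain g where g: "g > 0" "\<And>x. x \<in> P \<longleftrightarrow> g dvd x"
      using int_subgroup_generator[of N P] A(4) by metis
    have "g dvd x - y" if "x \<in> A" "y \<in> A" for x y
      using that AP g(2) by (intro dvd_diff) auto
    then have "g dvd 1" by (rule coprime_diffsD[OF cop])
    then have "x \<in> P" for x using g(2) dvd_trans[OF _ one_dvd] by blast
    then have "{0..<N} \<subseteq> A - {N}"
      using PA by auto
    then have "card {0..<N} \<le> card (A - {N})" using finA by (intro card_mono) auto
    moreover have "int (card {0..<N}) = N" using A(4) by simp
    ultimately show False using crit cA A(4) by linarith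
  qed
  have mod_d: "x mod d \<in> P \<longleftrightarrow> x \<in> P" for x
  proof -
    have "d * (x div d) \<in> H" using d(2) by simp
    then have "x mod d \<in> P \<longleftrightarrow> x mod d + d * (x div d) \<in> P" unfolding H_def by blast
    then show ?thesis by simp
  qed
  have shift: "x + j * d \<in> P \<longleftrightarrow> x \<in> P" for x j
  proof -
    have "j * d \<in> H" using d(2) by simp
    then show ?thesis unfolding H_def by blast
  qed
  define a' b' where "a' = a mod d" and "b' = b mod d"
  have a'b': "a' \<in> P" "b' \<in> P" "0 \<le> a'" "a' < d" "0 \<le> b'" "b' < d"
    using ab d(1) mod_d by (simp_all add: a'_def b'_def)
  have "(a' + b') mod d = (a + b) mod d" by (simp add: a'_def b'_def mod_add_eq)
  then have nP: "a' + b' \<notin> P" using mod_d ab(3) by metis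
  \<comment> \<open>With \<open>a', b' < d\<close> the sum \<open>a' + b'\<close> may exceed
    \<open>d\<close>, so only the shifts with \<open>j < e - 1\<close> are sure to stay below
    \<open>N\<close>. Each is represented twice: as \<open>a' + (b' + j * d)\<close>, and after
    adding \<open>N\<close> as \<open>(a' + (e - 1) * d) + (b' + (j + 1) * d)\<close>.\<close>
  define Y where "Y = (\<lambda>j. a' + b' + j * d) ` {0..<e - 1}"
  have cY: "int (card Y) = e - 1"
    using d(1) epos by (simp add: Y_def card_image inj_on_def)
  have "Y \<subseteq> {0..<N} - A" "\<And>r. r \<in> Y \<Longrightarrow> r \<in> A + A \<and> r + N \<in> A + A"
  proof -
    have *: "r \<in> {0..<N} - A \<and> r \<in> A + A \<and> r + N \<in> A + A" if "r \<in> Y" for r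
    proof -
      from that obtain j where j: "0 \<le> j" "j < e - 1" "r = a' + b' + j * d"
        by (auto simp: Y_def)
      have jd: "0 \<le> j * d" using j(1) d(1) by simp
      have "(j + 2) * d \<le> e * d" using j(2) d(1) by (intro mult_right_mono) auto
      then have jd2: "j * d + 2 * d \<le> N" using e by (simp add: algebra_simps)
      have "r \<notin> P" using nP shift j(3) by blast
      then have 1: "r \<in> {0..<N} - A" using AP a'b' jd jd2 j(3) by auto
      have "a' \<in> A" "b' + j * d \<in> A"
        using PA a'b' jd jd2 d(1) shift by auto
      then have "a' + (b' + j * d) \<in> A + A" by (rule set_plus_intro)
      then have 2: "r \<in> A + A" by (simp add: j(3) add.assoc)
      have "a' + (e - 1) * d \<in> P" "b' + (j + 1) * d \<in> P" using a'b' shift by blast+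
      moreover have ed: "(e - 1) * d = N - d" "(j + 1) * d = j * d + d"
        using e by (simp_all add: algebra_simps)
      ultimately have "a' + (N - d) \<in> A" "b' + (j * d + d) \<in> A"
        using PA a'b' jd jd2 d(1) by auto
      then have "a' + (N - d) + (b' + (j * d + d)) \<in> A + A" by (rule set_plus_intro)
      moreover have "a' + (N - d) + (b' + (j * d + d)) = r + N" by (simp add: j(3))
      ultimately show ?thesis using 1 2 by metis
    qed
    then show "Y \<subseteq> {0..<N} - A" "\<And>r. r \<in> Y \<Longrightarrow> r \<in> A + A \<and> r + N \<in> A + A" by blast+
  qed
  then have "N - int (card X) + int (card A) + int (card Y) \<le> int (card (A + A))"
    by (rule card_sumset_residues[OF A X_def])
  \<comment> \<open>\<open>N - e + card A + (e - 1)\<close> is \<open>3 * card A - 3\<close>, as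
    \<open>N = 2 * card A - 2\<close>.\<close>
  then show ?thesis using cX cY crit by linarith
qed

section \<open>Dense blocks\<close>

text \<open>For \<open>n = l + w\<close>, the elements of \<open>A\<close> up to \<open>w\<close>
  fill more than half of \<open>[l, w]\<close>, so this part meets its reflection
  \<open>x \<mapsto> n - x\<close>. The density at \<open>w\<close> is read off at the next element
  of \<open>A\<close>, which has the same elements before it, or from \<open>t\<close> if no further
  element lies before \<open>q\<close>.\<close>

lemma dense_prefix_sumset:
  fixes A :: "int set"
  assumes fin: "finite A" and A: "A \<subseteq> {l..}" and t: "t = int (card (A \<inter> {..<q}))"
    and dense: "\<And>z. \<lbrakk>z \<in> A; l < z; z < q\<rbrakk> \<Longrightarrow> z - l < 2 * int (card (A \<inter> {..<z}))"
    and q: "2 * t \<le> q - l"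
  shows "{2 * l..2 * l + 2 * t - 2} \<subseteq> A + A"
proof
  fix n assume n: "n \<in> {2 * l..2 * l + 2 * t - 2}"
  define w where "w = n - l"
  have w: "l \<le> w" "w \<le> l + 2 * t - 2" "w < q" using n q by (auto simp: w_def)
  define E where "E = A \<inter> {..w}"
  have finE: "finite E" using fin by (simp add: E_def)
  have "w - l + 2 \<le> 2 * int (card E)"
  proof (cases "\<exists>z\<in>A. w < z \<and> z < q")
    case True
    define Z where "Z = {z \<in> A. w < z \<and> z < q}"
    have Z: "finite Z" "Z \<noteq> {}" using fin True by (auto simp: Z_def)
    define z where "z = Min Z"
    have z: "z \<in> A" "w < z" "z < q" using Min_in[OF Z] by (auto simp: z_def Z_def)
    have "y \<le> w" if "y \<in> A" "y < z" for y
    proof (rule ccontr)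
      assume "\<not> y \<le> w"
      then have "y \<in> Z" using that z(3) by (simp add: Z_def)
      then show False using Min_le[OF Z(1)] that(2) by (force simp: z_def)
    qed
    then have "A \<inter> {..<z} = E" using z(2) by (auto simp: E_def)
    then show ?thesis using dense[OF z(1) _ z(3)] w z(2) by simp
  next
    case False
    then have "A \<inter> {..<q} = E" using w(3) by (auto simp: E_def)
    then show ?thesis using t w(2) by simp
  qed
  moreover have "E \<inter> (\<lambda>x. n - x) ` E \<noteq> {}" if "w - l + 2 \<le> 2 * int (card E)"
  proof
    assume "E \<inter> (\<lambda>x. n - x) ` E = {}"
    then have "card (E \<union> (\<lambda>x. n - x) ` E) = card E + card ((\<lambda>x. n - x) ` E)"
      using finE by (intro card_Un_disjoint) auto
    moreover have "card ((\<lambda>x. n - x) ` E) = card E" by (simp add: card_image inj_on_def)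
    moreover have "E \<union> (\<lambda>x. n - x) ` E \<subseteq> {l..w}" using A by (auto simp: E_def w_def)
    then have "card (E \<union> (\<lambda>x. n - x) ` E) \<le> card {l..w}" by (intro card_mono) auto
    moreover have "int (card {l..w}) = w - l + 1" using w(1) by simp
    ultimately show False using that by linarith
  qed
  ultimately obtain x y where "x \<in> E" "y \<in> E" "x = n - y" by blast
  then have "x \<in> A" "y \<in> A" "n = x + y" by (auto simp: E_def)
  then show "n \<in> A + A" by (simp add: set_plus_intro)
qed

text \<open>The level \<open>z - l - 2 |A \<inter> {..<z}|\<close> drops by at most one from an element of \<open>A\<close> to the next.
  If no inner element has a level between \<open>0\<close> and that of \<open>u\<close>, then the levels are negative up to
  some point and exceed that of \<open>u\<close> from there on, so \<open>A\<close> splits into two dense blocks.\<close>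

lemma card_sumset_two_blocks:
  fixes A :: "int set"
  assumes A: "A \<subseteq> {l..u}" "l \<in> A" "u \<in> A" "l < u"
    and sparse: "2 * int (card A) - 2 \<le> u - l"
    and unbalanced: "\<And>z. \<lbrakk>z \<in> A; l < z; z < u\<rbrakk> \<Longrightarrow>
      z - l < 2 * int (card (A \<inter> {..<z})) \<or>
      u - l - 2 * int (card A) + 2 < z - l - 2 * int (card (A \<inter> {..<z}))"
  shows "3 * int (card A) - 3 \<le> int (card (A + A))"
proof -
  define r where "r = (\<lambda>z. int (card (A \<inter> {..<z})))"
  have fin: "finite A" using A(1) finite_subset by blast
  have gt: "int (card (A \<inter> {z<..})) = int (card A) - 1 - r z" if "z \<in> A" for z
  proof -
    have "A = insert z (A \<inter> {..<z} \<union> A \<inter> {z<..})" using that by auto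
    then have "card A = card (insert z (A \<inter> {..<z} \<union> A \<inter> {z<..}))" by simp
    also have "\<dots> = Suc (card (A \<inter> {..<z} \<union> A \<inter> {z<..}))"
      using fin by (intro card_insert_disjoint) auto
    also have "card (A \<inter> {..<z} \<union> A \<inter> {z<..}) = card (A \<inter> {..<z}) + card (A \<inter> {z<..})"
      using fin by (intro card_Un_disjoint) auto
    finally show ?thesis by (simp add: r_def)
  qed
  have "A \<inter> {u<..} = {}" using A(1) by auto
  then have ru: "r u = int (card A) - 1" using gt[OF A(3)] by simp
  have pred: "\<exists>p\<in>A. p < z \<and> A \<inter> {..<z} = A \<inter> {..p} \<and> r z = r p + 1" if "l < z" for z
  proof -
    have ne: "A \<inter> {..<z} \<noteq> {}" "finite (A \<inter> {..<z})" using A(2) that fin by auto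
    define p where "p = Max (A \<inter> {..<z})"
    have p: "p \<in> A" "p < z" using Max_in[OF ne(2,1)] by (auto simp: p_def)
    have "y \<le> p" if "y \<in> A" "y < z" for y
      using Max_ge[OF ne(2), of y] that by (simp add: p_def)
    then have eq: "A \<inter> {..<z} = A \<inter> {..p}" using p(2) by auto
    have "A \<inter> {..p} = insert p (A \<inter> {..<p})" using p(1) by auto
    then have "card (A \<inter> {..p}) = Suc (card (A \<inter> {..<p}))" using fin by simp
    then show ?thesis using p eq by (auto simp: r_def)
  qed
  \<comment> \<open>\<open>T\<close> collects the elements of nonnegative level after
    \<open>l\<close>. Its minimum \<open>q\<close> opens the upper block, and the predecessor
    \<open>p\<close> of \<open>q\<close> closes the lower one.\<close>
  define T where "T = {z \<in> A. l < z \<and> 2 * r z \<le> z - l}"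
  have "u \<in> T" using A ru sparse by (simp add: T_def)
  then have T: "finite T" "T \<noteq> {}" using fin by (auto simp: T_def)
  define q where "q = Min T"
  have q: "q \<in> A" "l < q" "2 * r q \<le> q - l" using Min_in[OF T] by (auto simp: q_def T_def)
  have "q \<le> u" using Min_le[OF T(1) \<open>u \<in> T\<close>] by (simp add: q_def)
  have below: "z - l < 2 * r z" if "z \<in> A" "l < z" "z < q" for z
    using that Min_le[OF T(1), of z] by (force simp: q_def T_def)
  obtain p where p: "p \<in> A" "p < q" "A \<inter> {..<q} = A \<inter> {..p}" "r q = r p + 1"
    using pred[OF q(2)] by blast
  have pl: "p - l \<le> 2 * r p"
  proof (cases "p = l")
    case False
    then have "l < p" using p(1) A(1) by force
    then show ?thesis using below[OF p(1)] p(2) by simp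
  qed (simp add: r_def)
  have "2 * r z \<le> z - l" if "z \<in> A" "q \<le> z" "z < u" for z
  proof (rule ccontr)
    assume "\<not> 2 * r z \<le> z - l"
    define Z where "Z = {z \<in> A. q \<le> z \<and> z < u \<and> z - l < 2 * r z}"
    have Z: "finite Z" "Z \<noteq> {}" using fin that \<open>\<not> 2 * r z \<le> z - l\<close> by (auto simp: Z_def)
    define y where "y = Min Z"
    have y: "y \<in> A" "q \<le> y" "y < u" "y - l < 2 * r y" using Min_in[OF Z] by (auto simp: y_def Z_def)
    have "q < y" using y q(3) by (cases "q = y") auto
    then obtain x where x: "x \<in> A" "x < y" "A \<inter> {..<y} = A \<inter> {..x}" "r y = r x + 1"
      using pred[of y] q(2) by auto
    have "q \<in> A \<inter> {..<y}" using q(1) \<open>q < y\<close> by simp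
    then have "q \<le> x" using x(3) by auto
    have "x \<notin> Z" using Min_le[OF Z(1), of x] x(2) by (auto simp: y_def)
    then have "2 * r x \<le> x - l" using x \<open>q \<le> x\<close> y(3) by (simp add: Z_def)
    then have "u - l - 2 * int (card A) + 2 < x - l - 2 * r x"
      using unbalanced[OF x(1)] \<open>q \<le> x\<close> q(2) x(2) y(3) by (auto simp: r_def)
    then show False using y(4) x(2,4) sparse by linarith
  qed
  then have above: "u - l - 2 * int (card A) + 2 < z - l - 2 * r z" if "z \<in> A" "q \<le> z" "z < u" for z
    using unbalanced[OF that(1) _ that(3)] that q(2) by (force simp: r_def)
  define t where "t = r q"
  define s where "s = int (card A) - t"
  have left: "{2 * l..2 * l + 2 * t - 2} \<subseteq> A + A"
  proof (rule dense_prefix_sumset[OF fin])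
    show "A \<subseteq> {l..}" using A(1) by auto
    show "t = int (card (A \<inter> {..<q}))" by (simp add: t_def r_def)
    show "2 * t \<le> q - l" using q(3) by (simp add: t_def)
    show "z - l < 2 * int (card (A \<inter> {..<z}))" if "z \<in> A" "l < z" "z < q" for z
      using below[OF that] by (simp add: r_def)
  qed
  have um: "uminus ` A \<inter> {..<- z} = uminus ` (A \<inter> {z<..})" for z by auto
  have s': "s = int (card (A \<inter> {p<..}))"
    using gt[OF p(1)] p(4) by (simp add: s_def t_def)
  \<comment> \<open>Reflection turns the upper block into a dense prefix: a level above that of
    \<open>u\<close> becomes a negative level measured from \<open>- u\<close>.\<close>
  have "{2 * (- u)..2 * (- u) + 2 * s - 2} \<subseteq> uminus ` A + uminus ` A"
  proof (rule dense_prefix_sumset)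
    show "finite (uminus ` A)" using fin by simp
    show "uminus ` A \<subseteq> {- u..}" using A(1) by auto
    show "s = int (card (uminus ` A \<inter> {..<- p}))"
      unfolding um card_uminus by (rule s')
    show "2 * s \<le> - p - - u" using sparse pl p(4) by (simp add: s_def t_def)
    fix z assume z: "z \<in> uminus ` A" "- u < z" "z < - p"
    define x where "x = - z"
    have x: "x \<in> A" "x < u" "p < x" using z by (auto simp: x_def)
    have "q \<le> x"
    proof (rule ccontr)
      assume "\<not> q \<le> x"
      then have "x \<in> A \<inter> {..<q}" using x(1) by simp
      then show False using p(3) x(3) by simp
    qed
    have "z = - x" by (simp add: x_def)
    have "card (uminus ` A \<inter> {..<z}) = card (A \<inter> {x<..})"
      unfolding \<open>z = - x\<close> um card_uminus ..
    then show "z - - u < 2 * int (card (uminus ` A \<inter> {..<z}))"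
      using gt[OF x(1)] above[OF x(1) \<open>q \<le> x\<close> x(2)] by (simp add: \<open>z = - x\<close>)
  qed
  then have right': "{- 2 * u..- 2 * u + 2 * s - 2} \<subseteq> uminus ` (A + A)"
    by (simp add: uminus_sumset)
  have right: "{2 * u - 2 * s + 2..2 * u} \<subseteq> A + A"
  proof
    fix n assume "n \<in> {2 * u - 2 * s + 2..2 * u}"
    then have "- n \<in> {- 2 * u..- 2 * u + 2 * s - 2}" by simp
    then have "- n \<in> uminus ` (A + A)" by (rule subsetD[OF right'])
    then show "n \<in> A + A" by (simp add: image_iff)
  qed
  \<comment> \<open>The mixed sums lie in \<open>[l + q, p + u]\<close>, strictly between the two
    intervals already found. The count is \<open>(2 * t - 1) + (2 * s - 1) + (card A - 1)\<close>
    with \<open>t + s = card A\<close>.\<close>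
  define W where "W = A \<inter> {..p} + A \<inter> {q..}"
  have "A \<inter> {..<q} \<union> A \<inter> {q..} = A" "(A \<inter> {..<q}) \<inter> (A \<inter> {q..}) = {}" by auto
  then have "card A = card (A \<inter> {..<q}) + card (A \<inter> {q..})"
    using card_Un_disjoint[of "A \<inter> {..<q}" "A \<inter> {q..}"] fin by simp
  moreover have "card (A \<inter> {..p}) + card (A \<inter> {q..}) \<le> card W + 1"
    unfolding W_def using fin p(1) q(1) by (intro card_sumset_ge) auto
  ultimately have cW: "int (card A) \<le> int (card W) + 1" using p(3) by simp
  have tpos: "t \<ge> 1" using p(4) by (simp add: t_def r_def)
  have "p < u" using p(2) \<open>q \<le> u\<close> by simp
  then have "A \<inter> {p<..} \<noteq> {}" using A(3) by auto
  then have spos: "s \<ge> 1" using fin s' card_gt_0_iff[of "A \<inter> {p<..}"] by simp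
  have W: "l + q \<le> x \<and> x \<le> p + u" if "x \<in> W" for x
  proof -
    from that obtain a b where "a \<in> A \<inter> {..p}" "b \<in> A \<inter> {q..}" "x = a + b"
      unfolding W_def by (auto elim!: set_plus_elim)
    moreover have "l \<le> a" "b \<le> u" using calculation A(1) by auto
    ultimately show ?thesis by auto
  qed
  have 1: "2 * t \<le> q - l" using q(3) by (simp add: t_def)
  have 2: "2 * s \<le> u - p" using sparse pl p(4) by (simp add: s_def t_def)
  have finW: "finite W" "finite (A + A)" using fin by (auto simp: W_def intro!: finite_set_plus)
  have "W \<subseteq> A + A" unfolding W_def by (rule set_plus_mono2) auto
  then have "card ({2 * l..2 * l + 2 * t - 2} \<union> W \<union> {2 * u - 2 * s + 2..2 * u}) \<le> card (A + A)"
    using left right finW by (intro card_mono) auto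
  moreover have "card ({2 * l..2 * l + 2 * t - 2} \<union> W \<union> {2 * u - 2 * s + 2..2 * u})
    = card ({2 * l..2 * l + 2 * t - 2} \<union> W) + card {2 * u - 2 * s + 2..2 * u}"
  proof (rule card_Un_disjoint)
    have "l \<le> p" using A(1) p(1) by auto
    then have "x < 2 * u - 2 * s + 2" if "x \<in> {2 * l..2 * l + 2 * t - 2} \<union> W" for x
      using that W[of x] 1 2 \<open>q \<le> u\<close> by auto
    then show "({2 * l..2 * l + 2 * t - 2} \<union> W) \<inter> {2 * u - 2 * s + 2..2 * u} = {}"
      by (meson atLeastAtMost_iff disjoint_iff not_less)
  qed (use finW in auto)
  moreover have "card ({2 * l..2 * l + 2 * t - 2} \<union> W) = card {2 * l..2 * l + 2 * t - 2} + card W"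
    using finW W 1 by (intro card_Un_disjoint) fastforce+
  moreover have "int (card {2 * l..2 * l + 2 * t - 2}) = 2 * t - 1"
    "int (card {2 * u - 2 * s + 2..2 * u}) = 2 * s - 1"
    using tpos spos by simp_all
  moreover have "int (card A) = t + s" by (simp add: s_def)
  ultimately show ?thesis using cW by linarith
qed

section \<open>Freiman's theorem\<close>

lemma coprime_diffs_mono: "\<lbrakk>coprime_diffs B; B \<subseteq> A\<rbrakk> \<Longrightarrow> coprime_diffs A"
  unfolding coprime_diffs_def by blast

text \<open>Sums above \<open>2 * c\<close> must come from the right part, sums below it from the
  left. Let \<open>w\<close> and \<open>v\<close> be the neighbours of \<open>c\<close>. If
  \<open>w + v > 2 * c\<close>, it is a sum of two elements from \<open>c\<close> on, one of them at
  least \<open>v\<close>, hence at least \<open>c + v > w + v\<close>; the other inequality fails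
  symmetrically. So \<open>v = c + d\<close> and \<open>w = c - d\<close>. For \<open>z > v\<close>
  the sum \<open>z + w\<close> splits into smaller elements of the right part, and induction puts
  that whole part in the class of \<open>c\<close> modulo \<open>d\<close>. Primitivity gives
  \<open>d = 1\<close>.\<close>

lemma saturated_cut_neighbours:
  fixes A :: "int set"
  assumes A: "finite A" "c \<in> A" "x \<in> A" "x < c" "y \<in> A" "c < y"
    and cop: "coprime_diffs (A \<inter> {c..})"
    and sat: "A + A \<subseteq> (A \<inter> {..c} + A \<inter> {..c}) \<union> (A \<inter> {c..} + A \<inter> {c..})"
  shows "c - 1 \<in> A" "c + 1 \<in> A"
proof -
  have right: "\<exists>a\<in>A. \<exists>b\<in>A. c \<le> a \<and> c \<le> b \<and> z = a + b" if "z \<in> A + A" "2 * c < z" for z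
  proof -
    have "z \<notin> A \<inter> {..c} + A \<inter> {..c}"
      using that(2) by (auto elim!: set_plus_elim)
    then have "z \<in> A \<inter> {c..} + A \<inter> {c..}" using sat that(1) by blast
    then show ?thesis by (auto elim!: set_plus_elim)
  qed
  have left: "\<exists>a\<in>A. \<exists>b\<in>A. a \<le> c \<and> b \<le> c \<and> z = a + b" if "z \<in> A + A" "z < 2 * c" for z
  proof -
    have "z \<notin> A \<inter> {c..} + A \<inter> {c..}"
      using that(2) by (auto elim!: set_plus_elim)
    then have "z \<in> A \<inter> {..c} + A \<inter> {..c}" using sat that(1) by blast
    then show ?thesis by (auto elim!: set_plus_elim)
  qed
  define v where "v = Min (A \<inter> {c<..})"
  define w where "w = Max (A \<inter> {..<c})"
  have fin: "finite (A \<inter> {c<..})" "finite (A \<inter> {..<c})" using A(1) by auto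
  have "A \<inter> {c<..} \<noteq> {}" using A(5,6) by auto
  then have v: "v \<in> A" "c < v" using Min_in[OF fin(1)] by (auto simp: v_def)
  have "A \<inter> {..<c} \<noteq> {}" using A(3,4) by auto
  then have w: "w \<in> A" "w < c" using Max_in[OF fin(2)] by (auto simp: w_def)
  have vmin: "v \<le> z" if "z \<in> A" "c < z" for z
    using Min_le[OF fin(1)] that by (simp add: v_def)
  have wmax: "z \<le> w" if "z \<in> A" "z < c" for z
    using Max_ge[OF fin(2)] that by (simp add: w_def)
  have vw: "w + v = 2 * c"
  proof (rule ccontr)
    assume "w + v \<noteq> 2 * c"
    then consider "2 * c < w + v" | "w + v < 2 * c" by linarith
    then show False
    proof cases
      case 1
      then obtain a b where ab: "a \<in> A" "b \<in> A" "c \<le> a" "c \<le> b" "w + v = a + b"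
        using right[OF set_plus_intro[OF w(1) v(1)]] by blast
      then show False using 1 vmin[OF ab(1)] vmin[OF ab(2)] w(2) by linarith
    next
      case 2
      then obtain a b where ab: "a \<in> A" "b \<in> A" "a \<le> c" "b \<le> c" "w + v = a + b"
        using left[OF set_plus_intro[OF w(1) v(1)]] by blast
      then show False using 2 wmax[OF ab(1)] wmax[OF ab(2)] v(2) by linarith
    qed
  qed
  define d where "d = v - c"
  have d: "0 < d" "w = c - d" using v(2) vw by (auto simp: d_def)
  have dvd: "d dvd z - c" if "z \<in> A" "c \<le> z" for z
    using that
  proof (induction "nat (z - c)" arbitrary: z rule: less_induct)
    case less
    show ?case
    proof (cases "z \<le> v")
      case True
      then have "z = c \<or> z = v" using vmin[OF less.prems(1)] less.prems(2) by linarith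
      then show ?thesis by (auto simp: d_def)
    next
      case False
      then have "2 * c < z + w" using vw by linarith
      then obtain a b where ab: "a \<in> A" "b \<in> A" "c \<le> a" "c \<le> b" "z + w = a + b"
        using right[OF set_plus_intro[OF less.prems(1) w(1)]] by blast
      have "a < z" "b < z" using ab w(2) by linarith+
      then have "d dvd a - c" "d dvd b - c"
        using less.hyps ab less.prems(2) by auto
      then have "d dvd (a - c) + (b - c) + d" by (intro dvd_add) auto
      moreover have "(a - c) + (b - c) + d = z - c" using ab(5) d(2) by simp
      ultimately show ?thesis by metis
    qed
  qed
  have "d dvd a - b" if "a \<in> A \<inter> {c..}" "b \<in> A \<inter> {c..}" for a b
    using dvd_diff[OF dvd[of a] dvd[of b]] that by simp
  then have "d dvd 1" by (rule coprime_diffsD[OF cop])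
  then have "d = 1" using d(1) by simp
  then have "v = c + 1" "w = c - 1" using d(2) d_def by auto
  then show "c - 1 \<in> A" "c + 1 \<in> A" using v w by auto
qed

text \<open>Two consecutive integers of \<open>A\<close> would lie in one part and make it
  primitive, so \<open>A\<close> has none. The cut can therefore move to the last element
  \<open>m\<close> before \<open>u\<close>: the right part \<open>{m, u}\<close> is imprimitive
  because \<open>u - m \<ge> 2\<close>, and it meets the bound \<open>3 * 2 - 3\<close> trivially.
  So one of the two one-sided lemmas applies, whether or not the left part is primitive.\<close>

lemma cut_imprimitive_both:
  fixes A :: "int set"
  assumes A: "A \<subseteq> {l..u}" "l \<in> A" "u \<in> A" "l < c" "c < u" "c \<in> A" "coprime_diffs A"
    and nc: "\<not> coprime_diffs (A \<inter> {..c})" "\<not> coprime_diffs (A \<inter> {c..})"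
    and IH: "\<And>m. \<lbrakk>m \<in> A; m < u; coprime_diffs (A \<inter> {..m});
        2 * int (card (A \<inter> {..m})) - 2 \<le> m - l\<rbrakk>
      \<Longrightarrow> 3 * int (card (A \<inter> {..m})) - 3 \<le> int (card (A \<inter> {..m} + A \<inter> {..m}))"
  shows "3 * int (card A) - 3 \<le> int (card (A + A))"
proof -
  have fin: "finite A" using A(1) finite_subset by blast
  obtain d where d: "\<not> d dvd 1" "\<And>x y. \<lbrakk>x \<in> A \<inter> {..c}; y \<in> A \<inter> {..c}\<rbrakk> \<Longrightarrow> d dvd x - y"
    using nc(1) by (rule not_coprime_diffsE) blast
  obtain e where e: "\<not> e dvd 1" "\<And>x y. \<lbrakk>x \<in> A \<inter> {c..}; y \<in> A \<inter> {c..}\<rbrakk> \<Longrightarrow> e dvd x - y"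
    using nc(2) by (rule not_coprime_diffsE) blast
  have gap: "x + 1 \<notin> A" if "x \<in> A" for x
  proof
    assume y: "x + 1 \<in> A"
    show False
    proof (cases "x + 1 \<le> c")
      case True
      then show False using d(2)[of "x + 1" x] d(1) y that by simp
    next
      case False
      then show False using e(2)[of "x + 1" x] e(1) y that by simp
    qed
  qed
  define m where "m = Max (A \<inter> {..<u})"
  have "finite (A \<inter> {..<u})" "A \<inter> {..<u} \<noteq> {}" using fin A by auto
  then have m: "m \<in> A" "m < u" "\<And>z. \<lbrakk>z \<in> A; z < u\<rbrakk> \<Longrightarrow> z \<le> m"
    using Max_in[of "A \<inter> {..<u}"] Max_ge[of "A \<inter> {..<u}"] by (auto simp: m_def)
  have um: "m + 2 \<le> u" using gap[OF m(1)] m(2) A(3) by (cases "u = m + 1") auto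
  have right: "A \<inter> {m..} = {m, u}"
  proof (intro equalityI subsetI)
    fix z assume z: "z \<in> A \<inter> {m..}"
    then have "z \<le> u" using A(1) by auto
    then show "z \<in> {m, u}" using z m(3)[of z] by (cases "z < u") auto
  qed (use m A(3) in auto)
  have c2: "card (A \<inter> {m..}) = 2" using m(2) by (simp add: right)
  let ?B = "A \<inter> {..m}"
  show ?thesis
  proof (cases "coprime_diffs ?B")
    case True
    \<comment> \<open>Without consecutive elements, \<open>?B\<close> and its shift by
      \<open>1\<close> are disjoint, which is the sparsity that the induction hypothesis asks
      for.\<close>
    have "card (?B \<union> (\<lambda>x. x + 1) ` ?B) = card ?B + card ((\<lambda>x. x + 1) ` ?B)"
      using fin gap by (intro card_Un_disjoint) auto
    moreover have "card ((\<lambda>x. x + 1) ` ?B) = card ?B" by (simp add: card_image)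
    moreover have "?B \<union> (\<lambda>x. x + 1) ` ?B \<subseteq> {l..m + 1}" using A(1) by auto
    then have "card (?B \<union> (\<lambda>x. x + 1) ` ?B) \<le> card {l..m + 1}" by (intro card_mono) auto
    moreover have "l \<le> m" using A(1) m(1) by auto
    then have "int (card {l..m + 1}) = m - l + 2" by simp
    ultimately have "2 * int (card ?B) - 2 \<le> m - l" by linarith
    then have "3 * int (card ?B) - 3 \<le> int (card (?B + ?B))"
      using IH m True by blast
    moreover have "\<not> coprime_diffs (A \<inter> {m..})"
    proof
      assume cop: "coprime_diffs (A \<inter> {m..})"
      have "u - m dvd x - y" if "x \<in> A \<inter> {m..}" "y \<in> A \<inter> {m..}" for x y
        using that unfolding right using dvd_minus_iff[of "u - m" "u - m"] by auto
      then have "u - m dvd 1" by (rule coprime_diffsD[OF cop])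
      then show False using um by simp
    qed
    ultimately show ?thesis using cut_right_imprimitive[OF fin m(1) A(7)] by blast
  next
    case False
    have "A \<inter> {m..} \<noteq> {}" using m(1) by auto
    then have "3 * int (card (A \<inter> {m..})) - 3 \<le> int (card (A \<inter> {m..} + A \<inter> {m..}))"
      using card_sumset_ge[of "A \<inter> {m..}" "A \<inter> {m..}"] fin c2 by simp
    then show ?thesis using cut_left_imprimitive[OF fin m(1) A(7) False] by blast
  qed
qed

text \<open>Freiman's \<open>3k - 3\<close> theorem. Cut \<open>A\<close> at an inner element \<open>c\<close> whose level lies between those
  of \<open>l\<close> and \<open>u\<close>, so that both parts are again sparse; by induction the two sumsets
  contain \<open>3 |A| - 4\<close> elements. If no mixed sum is new, then \<open>c - 1\<close> and \<open>c + 1\<close> lie in \<open>A\<close>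
  and adjoining \<open>c - 1\<close> to the right part creates only two new sums, although the
  induction hypothesis for the larger part predicts three.\<close>

theorem card_sumset_sparse:
  fixes A :: "int set"
  assumes "A \<subseteq> {l..u}" "l \<in> A" "u \<in> A" "coprime_diffs A" "2 * int (card A) - 2 \<le> u - l"
  shows "3 * int (card A) - 3 \<le> int (card (A + A))"
  using assms
proof (induction "card A" arbitrary: A l u rule: less_induct)
  case less
  note A = less.prems(1-3) and cop = less.prems(4) and sparse = less.prems(5)
  have fin: "finite A" using A(1) finite_subset by blast
  let ?goal = "3 * int (card A) - 3 \<le> int (card (A + A))"
  have "l \<noteq> u"
  proof
    assume "l = u"
    then have "A = {l}" using A by auto
    \<comment> \<open>A singleton fails at the divisor \<open>0\<close>, which divides all its
      differences but not \<open>1\<close>.\<close>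
    then show False using coprime_diffsD[OF cop, of 0] by simp
  qed
  then have "l < u" using A by force
  have cardlt: "card B < card A" if "B \<subseteq> A" "x \<in> A" "x \<notin> B" for B x
    using psubset_card_mono[OF fin, of B] that by blast
  have left: "3 * int (card (A \<inter> {..c})) - 3 \<le> int (card (A \<inter> {..c} + A \<inter> {..c}))"
    if "c \<in> A" "c < u" "coprime_diffs (A \<inter> {..c})" "2 * int (card (A \<inter> {..c})) - 2 \<le> c - l" for c
  proof (rule less.hyps)
    show "card (A \<inter> {..c}) < card A" using that(2) A(3) by (intro cardlt[of _ u]) auto
    have "l \<le> c" using A(1) that(1) by auto
    then show "A \<inter> {..c} \<subseteq> {l..c}" "l \<in> A \<inter> {..c}" "c \<in> A \<inter> {..c}"
      using A that(1) by auto
  qed (use that in auto)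
  have right: "3 * int (card (A \<inter> {c..})) - 3 \<le> int (card (A \<inter> {c..} + A \<inter> {c..}))"
    if "c \<in> A" "l < c" "coprime_diffs (A \<inter> {c..})" "2 * int (card (A \<inter> {c..})) - 2 \<le> u - c" for c
  proof (rule less.hyps)
    show "card (A \<inter> {c..}) < card A" using that(2) A(2) by (intro cardlt[of _ l]) auto
    have "c \<le> u" using A(1) that(1) by auto
    then show "A \<inter> {c..} \<subseteq> {c..u}" "c \<in> A \<inter> {c..}" "u \<in> A \<inter> {c..}"
      using A that(1) by auto
  qed (use that in auto)
  define bal where "bal = (\<lambda>c. c \<in> A \<and> l < c \<and> c < u \<and> 2 * int (card (A \<inter> {..c})) - 2 \<le> c - l
    \<and> 2 * int (card (A \<inter> {c..})) - 2 \<le> u - c)"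
  have cut: ?goal if c: "bal c" and fail: "\<not> (coprime_diffs (A \<inter> {..c}) \<and> coprime_diffs (A \<inter> {c..}) \<and>
      A + A \<subseteq> (A \<inter> {..c} + A \<inter> {..c}) \<union> (A \<inter> {c..} + A \<inter> {c..}))" for c
  proof -
    have c': "c \<in> A" "l < c" "c < u" using c by (auto simp: bal_def)
    have L: "3 * int (card (A \<inter> {..c})) - 3 \<le> int (card (A \<inter> {..c} + A \<inter> {..c}))"
      if "coprime_diffs (A \<inter> {..c})" using left that c by (simp add: bal_def)
    have R: "3 * int (card (A \<inter> {c..})) - 3 \<le> int (card (A \<inter> {c..} + A \<inter> {c..}))"
      if "coprime_diffs (A \<inter> {c..})" using right that c by (simp add: bal_def)
    consider "coprime_diffs (A \<inter> {..c})" "coprime_diffs (A \<inter> {c..})"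
      | "coprime_diffs (A \<inter> {..c})" "\<not> coprime_diffs (A \<inter> {c..})"
      | "\<not> coprime_diffs (A \<inter> {..c})" "coprime_diffs (A \<inter> {c..})"
      | "\<not> coprime_diffs (A \<inter> {..c})" "\<not> coprime_diffs (A \<inter> {c..})" by blast
    then show ?goal
    proof cases
      case 1
      then obtain z where "z \<in> A + A" "z \<notin> A \<inter> {..c} + A \<inter> {..c}" "z \<notin> A \<inter> {c..} + A \<inter> {c..}"
        using fail by blast
      then have "card (A \<inter> {..c} + A \<inter> {..c}) + card (A \<inter> {c..} + A \<inter> {c..}) + card {z}
        \<le> card (A + A) + 1"
        by (intro cut_sumset[OF fin c'(1)]) auto
      then show ?goal using L[OF 1(1)] R[OF 1(2)] cut_card[OF fin c'(1)] by simp
    next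
      case 2
      then show ?goal using cut_right_imprimitive[OF fin c'(1) cop] L by blast
    next
      case 3
      then show ?goal using cut_left_imprimitive[OF fin c'(1) cop] R by blast
    next
      case 4
      then show ?goal
        using cut_imprimitive_both[OF A c'(2,3,1) cop 4] left by blast
    qed
  qed
  \<comment> \<open>The extra unit in \<open>lt\<close> is exactly what keeps the right part sparse
    after \<open>c - 1\<close> is adjoined.\<close>
  have strict: ?goal if c: "bal c" and lt: "2 * int (card (A \<inter> {c..})) - 1 \<le> u - c" for c
  proof (rule ccontr)
    assume contr: "\<not> ?goal"
    let ?B = "A \<inter> {..c}" and ?C = "A \<inter> {c..}"
    have c': "c \<in> A" "l < c" "c < u" using c by (auto simp: bal_def)
    have sat: "coprime_diffs ?B" "coprime_diffs ?C" "A + A \<subseteq> (?B + ?B) \<union> (?C + ?C)"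
      using cut[OF c] contr by blast+
    have c1: "c - 1 \<in> A"
      using saturated_cut_neighbours(1)[OF fin c'(1) A(2) c'(2) A(3) c'(3) sat(2,3)] .
    let ?D = "A \<inter> {c - 1..}"
    have D: "?D = insert (c - 1) ?C" using c1 by auto
    have cD: "card ?D = Suc (card ?C)" unfolding D using fin by (intro card_insert_disjoint) auto
    \<comment> \<open>The enlarged part must still be smaller than \<open>A\<close> for the
      induction hypothesis; at \<open>c - 1 = l\<close> the left part would be too dense to be
      balanced.\<close>
    have "c - 1 \<noteq> l"
    proof
      assume "c - 1 = l"
      then have "{l, c} \<subseteq> ?B" using A(2) c' by auto
      then have "card {l, c} \<le> card ?B" using fin by (intro card_mono) auto
      then show False using c \<open>c - 1 = l\<close> by (auto simp: bal_def)
    qed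
    then have "l < c - 1" using c'(2) by simp
    moreover have "coprime_diffs ?D" using sat(2) by (rule coprime_diffs_mono) auto
    ultimately have "3 * int (card ?D) - 3 \<le> int (card (?D + ?D))"
      using right[OF c1] lt cD by simp
    \<comment> \<open>A sum of at least \<open>2 * c\<close> lies in \<open>?C + ?C\<close> by
      saturation, since \<open>?B + ?B\<close> ends at \<open>2 * c\<close>. Below
      \<open>2 * c\<close> only \<open>c - 1\<close> and \<open>c\<close> can take part.\<close>
    moreover have "?D + ?D \<subseteq> (?C + ?C) \<union> {2 * c - 2, 2 * c - 1}"
    proof
      fix z assume "z \<in> ?D + ?D"
      then obtain a b where ab: "a \<in> ?D" "b \<in> ?D" "z = a + b" by (auto elim!: set_plus_elim)
      have in_C: "x \<in> ?C" if "x \<in> ?D" "x \<noteq> c - 1" for x using that by auto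
      show "z \<in> (?C + ?C) \<union> {2 * c - 2, 2 * c - 1}"
      proof (cases "z < 2 * c")
        case True
        then show ?thesis using ab by auto
      next
        case False
        have "z \<in> A + A" using ab by (auto intro: set_plus_intro)
        then have "z \<in> ?C + ?C" if "z \<notin> ?B + ?B" using sat(3) that by blast
        moreover have "z \<in> ?C + ?C" if "z \<in> ?B + ?B"
        proof -
          have "z \<le> 2 * c" using that by (auto elim!: set_plus_elim)
          then have "z = c + c" using False by simp
          moreover have "c + c \<in> ?C + ?C" using c'(1) by (intro set_plus_intro) auto
          ultimately show ?thesis by metis
        qed
        ultimately show ?thesis by blast
      qed
    qed
    then have "card (?D + ?D) \<le> card ((?C + ?C) \<union> {2 * c - 2, 2 * c - 1})"
      using fin by (intro card_mono) (auto intro!: finite_set_plus)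
    moreover have "card ((?C + ?C) \<union> {2 * c - 2, 2 * c - 1}) \<le> card (?C + ?C) + card {2 * c - 2, 2 * c - 1}"
      by (rule card_Un_le)
    moreover have "card {2 * c - 2, 2 * c - 1} = 2" by simp
    moreover have "3 * int (card ?B) - 3 \<le> int (card (?B + ?B))"
      using left[OF c'(1,3) sat(1)] c by (simp add: bal_def)
    moreover have "card (?B + ?B) + card (?C + ?C) + card ({} :: int set) \<le> card (A + A) + 1"
      by (rule cut_sumset[OF fin c'(1)]) auto
    ultimately show False using contr cD cut_card[OF fin c'(1)] by simp
  qed
  show ?case
  proof (cases "u - l = 2 * int (card A) - 2")
    case True
    let ?T = "(\<lambda>x. x - l) ` A"
    have cT: "card ?T = card A" by (simp add: card_image inj_on_def)
    have "3 * int (card ?T) - 3 \<le> int (card (?T + ?T))"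
    proof (rule card_sumset_critical)
      show "?T \<subseteq> {0..u - l}" "u - l \<in> ?T" "0 < u - l" using A \<open>l < u\<close> by auto
      show "0 \<in> ?T" using A(2) by force
      show "coprime_diffs ?T" using cop by (simp only: coprime_diffs_translate)
      show "u - l = 2 * int (card ?T) - 2" using True cT by simp
    qed
    then show ?thesis by (simp only: cT card_sumset_translate)
  next
    case False
    then have super: "2 * int (card A) - 1 \<le> u - l" using sparse by linarith
    show ?thesis
    proof (cases "\<exists>c. bal c")
      case True
      then obtain c where c: "bal c" by blast
      then have c': "c \<in> A" "l < c" "c < u" by (auto simp: bal_def)
      show ?thesis
      proof (cases "2 * int (card (A \<inter> {c..})) - 1 \<le> u - c")
        case True
        then show ?thesis using strict[OF c] by blast
      next
        case False
        then have lev: "u - c = 2 * int (card (A \<inter> {c..})) - 2" using c by (simp add: bal_def)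
        show ?thesis
        proof (rule ccontr)
          assume contr: "\<not> ?thesis"
          let ?B = "A \<inter> {..c}" and ?C = "A \<inter> {c..}"
          have sat: "coprime_diffs ?C" "A + A \<subseteq> (?B + ?B) \<union> (?C + ?C)"
            using cut[OF c] contr by blast+
          \<comment> \<open>The right part is tight at \<open>c\<close>. The slack
            \<open>super\<close> then sits on the left, so the cut moves to \<open>c + 1\<close>,
            where the right part has the unit that \<open>strict\<close> needs.\<close>
          have c1: "c + 1 \<in> A"
            using saturated_cut_neighbours(2)[OF fin c'(1) A(2) c'(2) A(3) c'(3) sat] .
          have "A \<inter> {..c + 1} = insert (c + 1) ?B" using c1 by auto
          then have cB: "card (A \<inter> {..c + 1}) = Suc (card ?B)"
            using fin by simp
          have "?C = insert c (A \<inter> {c + 1..})" using c'(1) by auto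
          then have cC: "card ?C = Suc (card (A \<inter> {c + 1..}))"
            using fin by simp
          \<comment> \<open>\<open>u - c\<close> is even.\<close>
          have "c + 1 \<noteq> u" using lev by presburger
          then have "bal (c + 1)"
            using c c1 lev super cB cC cut_card[OF fin c'(1)] by (simp add: bal_def)
          then show False using strict[of "c + 1"] contr lev cC by simp
        qed
      qed
    next
      case False
      show ?thesis
      proof (rule card_sumset_two_blocks[OF A \<open>l < u\<close> sparse])
        fix z assume z: "z \<in> A" "l < z" "z < u"
        have "A \<inter> {..z} = insert z (A \<inter> {..<z})" using z(1) by auto
        then have "card (A \<inter> {..z}) = Suc (card (A \<inter> {..<z}))" using fin by simp
        moreover have "\<not> bal z" using False by blast
        ultimately show "z - l < 2 * int (card (A \<inter> {..<z})) \<or>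
          u - l - 2 * int (card A) + 2 < z - l - 2 * int (card (A \<inter> {..<z}))"
          using z cut_card[OF fin z(1)] by (auto simp: bal_def)
      qed
    qed
  qed
qed

theorem card_sumset_freiman:
  fixes A :: "int set"
  assumes A: "A \<subseteq> {l..u}" "l \<in> A" "u \<in> A" and cop: "coprime_diffs A"
  shows "min (3 * int (card A) - 3) (int (card A) + (u - l)) \<le> int (card (A + A))"
proof (cases "2 * int (card A) - 2 \<le> u - l")
  case True
  then show ?thesis using card_sumset_sparse[OF assms] by simp
next
  case False
  show ?thesis
  proof (cases "l = u")
    case True
    then have "A = {l}" using A by auto
    then show ?thesis using True by simp
  next
    case False
    then have "l < u" using A by force
    let ?T = "(\<lambda>x. x - l) ` A"
    have cT: "card ?T = card A" by (simp add: card_image inj_on_def)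
    have "int (card ?T) + (u - l) \<le> int (card (?T + ?T))"
    proof (rule card_sumset_dense)
      show "?T \<subseteq> {0..u - l}" "u - l \<in> ?T" "0 < u - l" using A \<open>l < u\<close> by auto
      show "0 \<in> ?T" using A(2) by force
      show "u - l \<le> 2 * int (card ?T) - 3" using \<open>\<not> 2 * int (card A) - 2 \<le> u - l\<close> cT by simp
    qed
    then show ?thesis by (simp add: cT card_sumset_translate)
  qed
qed

section \<open>The lower bound for upper densities\<close>

lemma upper_density_le:
  assumes "\<forall>\<^sub>F N in sequentially. real (card (A \<inter> {1..N})) \<le> b * real N"
  shows "upper_density A \<le> b"
proof -
  have "\<forall>\<^sub>F N in sequentially. ereal (real (card (A \<inter> {1..N})) / real N) \<le> ereal b"
    using assms eventually_gt_at_top[of 0]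
    by eventually_elim (simp add: divide_le_eq mult.commute)
  then have "limsup (\<lambda>N. ereal (real (card (A \<inter> {1..N})) / real N)) \<le> ereal b"
    by (rule Limsup_bounded)
  then show ?thesis unfolding ereal_upper_density[symmetric] by simp
qed

lemma upper_density_ge:
  assumes "\<exists>\<^sub>F N in sequentially. b * real N \<le> real (card (A \<inter> {1..N}))"
  shows "b \<le> upper_density A"
proof (rule ccontr)
  assume "\<not> b \<le> upper_density A"
  then have "limsup (\<lambda>N. ereal (real (card (A \<inter> {1..N})) / real N)) < ereal b"
    unfolding ereal_upper_density[symmetric] by simp
  then have "\<forall>\<^sub>F N in sequentially. ereal (real (card (A \<inter> {1..N})) / real N) < ereal b"
    by (rule Limsup_lessD)
  then have "\<forall>\<^sub>F N in sequentially. \<not> b * real N \<le> real (card (A \<inter> {1..N}))"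
    using eventually_gt_at_top[of 0]
    by eventually_elim (simp add: divide_less_eq mult.commute)
  then show False using assms by (simp add: frequently_def)
qed

lemma frequently_less_upper_density:
  assumes "b < upper_density A"
  shows "\<exists>\<^sub>F N in sequentially. b * real N < real (card (A \<inter> {1..N}))"
  using upper_density_le[of A b] assms by (auto simp: frequently_def not_less)

lemma card_Int_atLeastAtMost_le: "card (A \<inter> {1..N}) \<le> N" for N :: nat
  using card_mono[of "{1..N}" "A \<inter> {1..N}"] by simp

lemma upper_density_nonneg: "0 \<le> upper_density A"
  by (rule upper_density_ge) simp

lemma upper_density_le_1: "upper_density A \<le> 1"
  by (rule upper_density_le) (simp add: card_Int_atLeastAtMost_le del: One_nat_def)

text \<open>Only finitely many divisors need excluding: once distinct \<open>x\<close> and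
  \<open>y\<close> are present, a common divisor of the differences is at most \<open>D\<close> in
  absolute value. Each bad one is ruled out from some point on.\<close>

lemma Gcd_diffset_finite_part:
  assumes "Gcd (diffset A) = 1"
  shows "\<forall>\<^sub>F n in sequentially. coprime_diffs (int ` (A \<inter> {..n}))"
proof -
  define bad where "bad = (\<lambda>d n. \<forall>x\<in>A \<inter> {..n}. \<forall>y\<in>A \<inter> {..n}. d dvd int x - int y)"
  have witness: "\<forall>\<^sub>F n in sequentially. \<not> bad d n" if "\<not> d dvd 1" for d
  proof -
    have "\<exists>x\<in>A. \<exists>y\<in>A. \<not> d dvd int x - int y"
    proof (rule ccontr)
      assume "\<not> (\<exists>x\<in>A. \<exists>y\<in>A. \<not> d dvd int x - int y)"
      then have "d dvd Gcd (diffset A)"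
        by (intro Gcd_greatest) (auto simp: diffset_def)
      then show False using assms that by simp
    qed
    then obtain x y where "x \<in> A" "y \<in> A" "\<not> d dvd int x - int y" by blast
    then have "\<not> bad d n" if "n \<ge> max x y" for n using that by (auto simp: bad_def)
    then show ?thesis unfolding eventually_sequentially by blast
  qed
  \<comment> \<open>The divisor \<open>0\<close> yields two distinct elements.\<close>
  obtain x y where xy: "x \<in> A" "y \<in> A" "x \<noteq> y"
    using witness[of 0] unfolding eventually_sequentially bad_def by force
  define D where "D = \<bar>int x - int y\<bar>"
  have "\<forall>\<^sub>F n in sequentially. \<forall>d\<in>{d \<in> {-D..D}. \<not> d dvd 1}. \<not> bad d n"
  proof (rule eventually_ball_finite)
    show "finite {d \<in> {-D..D}. \<not> d dvd 1}" by (rule finite_subset[of _ "{-D..D}"]) auto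
  qed (use witness in blast)
  then show ?thesis
    using eventually_ge_at_top[of "max x y"]
  proof eventually_elim
    case (elim n)
    show ?case
      unfolding coprime_diffs_def
    proof (intro allI impI)
      fix d assume d: "\<forall>x\<in>int ` (A \<inter> {..n}). \<forall>y\<in>int ` (A \<inter> {..n}). d dvd x - y"
      then have "d dvd int x - int y" using xy elim(2) by auto
      then have "\<bar>d\<bar> \<le> D" using xy(3) dvd_imp_le_int[of "int x - int y" d] by (simp add: D_def)
      then have "d \<in> {-D..D}" by auto
      moreover have "bad d n" using d by (simp add: bad_def)
      ultimately show "d dvd 1" using elim(1) by blast
    qed
  qed
qed

lemma int_sumset: "int ` (A + B) = int ` A + int ` B"
proof (intro equalityI subsetI)
  fix z assume "z \<in> int ` (A + B)"
  then obtain a b where "a \<in> A" "b \<in> B" "z = int a + int b" by (auto elim!: set_plus_elim)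
  then show "z \<in> int ` A + int ` B" by (metis imageI set_plus_intro)
next
  fix z assume "z \<in> int ` A + int ` B"
  then obtain a b where "a \<in> A" "b \<in> B" "z = int (a + b)" by (auto elim!: set_plus_elim)
  then show "z \<in> int ` (A + B)" by (blast intro: set_plus_intro)
qed

lemma card_sumset_freiman_nat:
  fixes A :: "nat set"
  assumes A: "A \<subseteq> {l..u}" "l \<in> A" "u \<in> A" and cop: "coprime_diffs (int ` A)"
  shows "min (3 * real (card A) - 3) (real (card A) + real u - real l) \<le> real (card (A + A))"
proof -
  have "min (3 * int (card (int ` A)) - 3) (int (card (int ` A)) + (int u - int l))
    \<le> int (card (int ` A + int ` A))"
    using assms by (intro card_sumset_freiman) auto
  then have "min (3 * int (card A) - 3) (int (card A) + (int u - int l)) \<le> int (card (A + A))"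
    by (simp add: int_sumset[symmetric] card_image)
  then show ?thesis by linarith
qed

text \<open>A cutoff \<open>N\<close> with many elements below it is lowered to the greatest element
  \<open>M \<le> N\<close> of \<open>A\<close>; the count stays and the ratio only grows, so
  Freiman's theorem applies on \<open>[a, M]\<close>. A level \<open>c\<close> strictly below the
  density is needed because the limit superior itself need not be attained.\<close>

lemma f_min_le_upper_density_sumset:
  assumes gcd: "Gcd (diffset A) = 1"
  shows "f_min (upper_density A) \<le> upper_density (A + A)"
proof (cases "upper_density A = 0")
  case True
  then show ?thesis using upper_density_nonneg[of "A + A"] by (simp add: f_min_def)
next
  case False
  then have pos: "0 < upper_density A" using upper_density_nonneg[of A] by simp
  have key: "f_min c - e \<le> upper_density (A + A)" if c: "0 < c" "c < upper_density A" and e: "e > 0" for c e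
  proof (rule upper_density_ge)
    obtain n0 where n0: "\<And>n. n \<ge> n0 \<Longrightarrow> coprime_diffs (int ` (A \<inter> {..n}))"
      using Gcd_diffset_finite_part[OF gcd] by (auto simp: eventually_sequentially)
    have "A \<noteq> {}" using coprime_diffsD[OF n0[of n0], of 0] by auto
    define a where "a = (LEAST x. x \<in> A)"
    have a: "a \<in> A" "\<And>x. x \<in> A \<Longrightarrow> a \<le> x"
      using \<open>A \<noteq> {}\<close> by (auto simp: a_def intro: LeastI Least_le)
    have freq: "\<exists>N\<ge>K. c * real N < real (card (A \<inter> {1..N}))" for K
      using frequently_less_upper_density[OF c(2)]
      unfolding frequently_sequentially by blast
    have "\<exists>M\<ge>K. (f_min c - e) * real M \<le> real (card ((A + A) \<inter> {1..M}))" for K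
    proof -
      \<comment> \<open>Chosen so that \<open>M \<ge> K\<close> and the error
        \<open>2 * e * M\<close> covers \<open>a + 4\<close>: at most \<open>3\<close> or
        \<open>a\<close> is lost in Freiman's bound, and \<open>1\<close> for the sum
        \<open>0\<close>, which is not counted.\<close>
      define R where "R = max (real K) ((real a + 4) / (2 * e)) + 1"
      obtain N where N: "N \<ge> max n0 (max a (nat \<lceil>R / c\<rceil>))" "c * real N < real (card (A \<inter> {1..N}))"
        using freq by blast
      define B where "B = A \<inter> {..N}"
      define k where "k = card B"
      have finB: "finite B" by (simp add: B_def)
      have "a \<in> B" using a N(1) by (simp add: B_def)
      then have "B \<noteq> {}" by blast
      define M where "M = Max B"
      have M: "M \<in> B" "\<And>x. x \<in> B \<Longrightarrow> x \<le> M"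
        using Max_in[OF finB \<open>B \<noteq> {}\<close>] Max_ge[OF finB] by (auto simp: M_def)
      have "M \<le> N" using M(1) by (simp add: B_def)
      have "card (A \<inter> {1..N}) \<le> k"
        unfolding k_def using finB by (intro card_mono) (auto simp: B_def)
      then have kN: "c * real N < real k" using N(2) by linarith
      have "c * real M \<le> c * real N" using \<open>M \<le> N\<close> c(1) by simp
      then have kM: "c * real M \<le> real k" using kN by linarith
      have "k \<le> card {..M}" unfolding k_def using M by (intro card_mono) auto
      then have "real k \<le> real M + 1" by simp
      moreover have "R / c \<le> real N" using N(1) by linarith
      then have "R \<le> c * real N" using c(1) by (simp add: divide_le_eq mult.commute)
      ultimately have "R - 1 < real M" using kN by linarith
      then have "real K \<le> real M" "(real a + 4) / (2 * e) \<le> real M" by (simp_all add: R_def)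
      then have MK: "K \<le> M" and Me: "real a + 4 \<le> 2 * e * real M"
        using e by (simp_all add: divide_le_eq mult.commute)
      have "min (3 * real k - 3) (real k + real M - real a) \<le> real (card (B + B))"
        unfolding k_def
      proof (rule card_sumset_freiman_nat)
        show "B \<subseteq> {a..M}" using M a by (auto simp: B_def)
        show "coprime_diffs (int ` B)" using n0 N(1) by (simp add: B_def)
      qed fact+
      moreover have "B + B \<subseteq> insert 0 ((A + A) \<inter> {1..2 * M})"
      proof
        fix z assume "z \<in> B + B"
        then obtain x y where xy: "x \<in> B" "y \<in> B" "z = x + y" by (auto elim!: set_plus_elim)
        then have "z \<in> A + A" by (auto simp: B_def intro: set_plus_intro)
        then show "z \<in> insert 0 ((A + A) \<inter> {1..2 * M})" using M(2)[OF xy(1)] M(2)[OF xy(2)] xy(3) by auto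
      qed
      then have "card (B + B) \<le> card (insert 0 ((A + A) \<inter> {1..2 * M}))" by (intro card_mono) auto
      then have "card (B + B) \<le> Suc (card ((A + A) \<inter> {1..2 * M}))"
        by (simp add: card_insert_if split: if_splits)
      ultimately have cnt: "min (3 * real k - 3) (real k + real M - real a) - 1
          \<le> real (card ((A + A) \<inter> {1..2 * M}))" by linarith
      have "2 * real M * f_min c \<le> 2 * real M * (3 * c / 2)"
        "2 * real M * f_min c \<le> 2 * real M * ((1 + c) / 2)"
        by (intro mult_left_mono; auto simp: f_min_def min_def)+
      then have "2 * real M * f_min c \<le> 3 * (c * real M)"
        "2 * real M * f_min c \<le> real M + c * real M"
        by (simp_all add: algebra_simps)
      then have "2 * real M * f_min c - 2 * e * real M \<le> real (card ((A + A) \<inter> {1..2 * M}))"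
        using cnt Me kM by (auto simp: min_def split: if_splits)
      then have "(f_min c - e) * real (2 * M) \<le> real (card ((A + A) \<inter> {1..2 * M}))"
        by (simp add: algebra_simps)
      then show ?thesis using MK by (intro exI[of _ "2 * M"]) auto
    qed
    then show "\<exists>\<^sub>F M in sequentially. (f_min c - e) * real M \<le> real (card ((A + A) \<inter> {1..M}))"
      unfolding frequently_sequentially by blast
  qed
  show ?thesis
  proof (rule field_le_epsilon)
    fix e :: real assume "e > 0"
    \<comment> \<open>The minimum keeps \<open>c\<close> positive. The slopes of
      \<open>f_min\<close> are at most \<open>3 / 2\<close>, so passing to \<open>c\<close> costs at
      most \<open>3 * e / 8\<close>.\<close>
    define c where "c = upper_density A - min (upper_density A) e / 4"
    have "0 < c" "c < upper_density A" using pos \<open>e > 0\<close> by (auto simp: c_def min_def)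
    then have "f_min c - e / 2 \<le> upper_density (A + A)" using \<open>e > 0\<close> by (intro key) auto
    moreover
    have "upper_density A - c \<le> e / 4" by (simp add: c_def)
    have "f_min (upper_density A) \<le> f_min c + 3 / 2 * (e / 4)"
    proof -
      have "f_min (upper_density A) \<le> 3 * upper_density A / 2"
        "f_min (upper_density A) \<le> (1 + upper_density A) / 2" by (auto simp: f_min_def min_def)
      moreover have "f_min c = 3 * c / 2 \<or> f_min c = (1 + c) / 2" by (simp add: f_min_def min_def)
      ultimately show ?thesis
        using \<open>c < upper_density A\<close> \<open>upper_density A - c \<le> e / 4\<close> by (elim disjE; simp add: field_simps)
    qed
    ultimately show "f_min (upper_density A) \<le> upper_density (A + A) + e"
      using \<open>e > 0\<close> by linarith
  qed
qed

section \<open>Sets with prescribed upper densities\<close>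

text \<open>Only the windows \<open>[p j, P j]\<close> matter: in the gap after \<open>P j\<close>
  the count is constant while \<open>x\<close> grows.\<close>

lemma upper_density_le_blocks:
  assumes \<beta>: "0 \<le> \<beta>" and p: "mono p" "\<And>j. j \<le> p j" "\<And>j. p j \<le> P j"
    and gap: "\<And>j. B \<inter> {P j<..<p (Suc j)} = {}"
    and bound: "\<And>j x. \<lbrakk>p j \<le> x; x \<le> P j\<rbrakk> \<Longrightarrow>
      real (card (B \<inter> {1..x})) \<le> (\<beta> + C / real (Suc j)) * real x"
  shows "upper_density B \<le> \<beta>"
proof (rule field_le_epsilon)
  fix e :: real assume e: "e > 0"
  obtain J :: nat where J: "\<bar>C\<bar> / e < real J" using reals_Archimedean2 by blast
  have small: "C / real (Suc j) \<le> e" if "j \<ge> J" for j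
  proof -
    have "C \<le> e * real J" using J e by (simp add: divide_less_eq mult.commute)
    also have "\<dots> \<le> e * real (Suc j)" using that e by simp
    finally show ?thesis by (simp add: divide_le_eq)
  qed
  have "real (card (B \<inter> {1..x})) \<le> (\<beta> + e) * real x" if x: "p J \<le> x" for x
  proof -
    define i where "i = (LEAST i. x < p i)"
    have "x < p (Suc x)" using p(2)[of "Suc x"] by simp
    then have i: "x < p i" unfolding i_def by (rule LeastI)
    have "J < i" using x i monoD[OF p(1), of i J] by (cases "J < i") auto
    then obtain j where j: "i = Suc j" "J \<le> j" by (cases i) auto
    then have pj: "p j \<le> x" using not_less_Least[of j "\<lambda>i. x < p i"] by (simp add: i_def)
    have *: "real (card (B \<inter> {1..y})) \<le> (\<beta> + e) * real y" if "p j \<le> y" "y \<le> P j" for y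
    proof -
      have "(\<beta> + C / real (Suc j)) * real y \<le> (\<beta> + e) * real y"
        using small[OF j(2)] by (intro mult_right_mono) auto
      then show ?thesis using bound[OF that] by linarith
    qed
    show ?thesis
    proof (cases "x \<le> P j")
      case True
      then show ?thesis using * pj by blast
    next
      case False
      have "B \<inter> {1..x} = B \<inter> {1..P j}"
      proof -
        have "y \<le> P j" if "y \<in> B" "y \<le> x" for y
        proof (rule ccontr)
          assume "\<not> y \<le> P j"
          then have "y \<in> B \<inter> {P j<..<p (Suc j)}" using that i j(1) by simp
          then show False using gap by blast
        qed
        then show ?thesis using False by auto
      qed
      then have "real (card (B \<inter> {1..x})) \<le> (\<beta> + e) * real (P j)" using *[of "P j"] p(3)[of j] by simp
      also have "\<dots> \<le> (\<beta> + e) * real x" using False \<beta> e by (intro mult_left_mono) auto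
      finally show ?thesis .
    qed
  qed
  then show "upper_density B \<le> \<beta> + e"
    by (intro upper_density_le) (auto simp: eventually_sequentially)
qed

lemma upper_density_ge_blocks:
  assumes p: "\<And>j. j \<le> p j"
    and bound: "\<And>j. (\<beta> - C / real (Suc j)) * real (p j) \<le> real (card (B \<inter> {1..p j}))"
  shows "\<beta> \<le> upper_density B"
proof (rule field_le_epsilon)
  fix e :: real assume e: "e > 0"
  obtain J :: nat where J: "\<bar>C\<bar> / e < real J" using reals_Archimedean2 by blast
  have "\<exists>x\<ge>K. (\<beta> - e) * real x \<le> real (card (B \<inter> {1..x}))" for K
  proof -
    define j where "j = max J K"
    have "C \<le> e * real J" using J e by (simp add: divide_less_eq mult.commute)
    also have "\<dots> \<le> e * real (Suc j)" using e by (simp add: j_def)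
    finally have "C / real (Suc j) \<le> e" by (simp add: divide_le_eq)
    then have "(\<beta> - e) * real (p j) \<le> (\<beta> - C / real (Suc j)) * real (p j)"
      by (intro mult_right_mono) auto
    then show ?thesis using bound[of j] p[of j] by (intro exI[of _ "p j"]) (auto simp: j_def)
  qed
  then have "\<beta> - e \<le> upper_density B"
    by (intro upper_density_ge) (simp only: frequently_sequentially, blast)
  then show "\<beta> \<le> upper_density B + e" by simp
qed

text \<open>At scale \<open>N = n ^ 4\<close> the sums \<open>(g + i) + b\<close> and \<open>(N - i) + b\<close> with \<open>i < n ^ 2\<close> and
  \<open>n ^ 2\<close> dividing \<open>b\<close> make \<open>thin g n\<close> a basis of order two. The shift by \<open>n ^ 3\<close>, which is
  negligible against \<open>N\<close> but not against the size of \<open>thin g n\<close>, keeps the blocks away from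
  the origin even for density \<open>1\<close>.\<close>

definition scale :: "nat \<Rightarrow> nat" where
  "scale j = 2 ^ 5 ^ j"

definition block_start :: "real \<Rightarrow> nat \<Rightarrow> nat" where
  "block_start \<alpha> n = nat \<lceil>(1 - \<alpha>) * real (n ^ 4)\<rceil> + n ^ 3"

definition thin :: "nat \<Rightarrow> nat \<Rightarrow> nat set" where
  "thin g n = {x \<in> {g..n ^ 4}. x < g + n ^ 2 \<or> n ^ 4 < x + n ^ 2 \<or> n ^ 2 dvd x}"

definition block :: "real \<Rightarrow> real \<Rightarrow> nat \<Rightarrow> nat set" where
  "block \<alpha> \<gamma> n = {block_start \<alpha> n..n ^ 4} \<union> thin (block_start \<gamma> n) n"

text \<open>The element \<open>0\<close> puts a copy of the set into its sumset; the pair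
  \<open>0\<close>, \<open>1\<close> makes the differences coprime.\<close>

definition lacunary :: "real \<Rightarrow> real \<Rightarrow> nat set" where
  "lacunary \<alpha> \<gamma> = {0, 1} \<union> (\<Union>j. block \<alpha> \<gamma> (scale j))"

text \<open>The exponent 5 makes \<open>m ^ 4 * m = n\<close> for consecutive scales
  \<open>m\<close> and \<open>n\<close>. Translating a set of about \<open>n ^ 2\<close> elements by
  everything up to \<open>m ^ 4\<close> thus yields about \<open>n ^ 3 / m\<close> sums, negligible
  from \<open>n ^ 3\<close> on.\<close>

lemma scale_Suc: "scale (Suc j) = scale j ^ 5"
  by (simp add: scale_def power_mult[symmetric] mult.commute)

lemma Suc_le_scale: "Suc j \<le> scale j"
proof -
  have "j \<le> 5 ^ j"
    using less_exp[of j] power_mono[of 2 "5 :: nat" j] by linarith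
  then have "(2 :: nat) ^ j \<le> 2 ^ 5 ^ j" by (intro power_increasing) auto
  then show ?thesis using less_exp[of j] unfolding scale_def by linarith
qed

lemma two_le_scale: "2 \<le> scale j"
  using self_le_power[of 2 "5 ^ j"] by (simp add: scale_def)

lemma mono_scale: "mono scale"
  by (auto simp: mono_def scale_def intro!: power_increasing)

lemma block_start_bounds:
  assumes "\<alpha> \<le> 1"
  shows "(1 - \<alpha>) * real (n ^ 4) + real (n ^ 3) \<le> real (block_start \<alpha> n)"
    and "real (block_start \<alpha> n) \<le> (1 - \<alpha>) * real (n ^ 4) + real (n ^ 3) + 1"
proof -
  have "0 \<le> (1 - \<alpha>) * real (n ^ 4)" using assms by simp
  then have "0 \<le> \<lceil>(1 - \<alpha>) * real (n ^ 4)\<rceil>" by linarith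
  then have "real (block_start \<alpha> n) = of_int \<lceil>(1 - \<alpha>) * real (n ^ 4)\<rceil> + real (n ^ 3)"
    by (simp add: block_start_def)
  then show "(1 - \<alpha>) * real (n ^ 4) + real (n ^ 3) \<le> real (block_start \<alpha> n)"
    "real (block_start \<alpha> n) \<le> (1 - \<alpha>) * real (n ^ 4) + real (n ^ 3) + 1"
    by linarith+
qed

lemma cube_le_block_start: "n ^ 3 \<le> block_start \<alpha> n"
  by (simp add: block_start_def)

lemma block_start_antimono: "\<alpha> \<le> \<gamma> \<Longrightarrow> block_start \<gamma> n \<le> block_start \<alpha> n"
  unfolding block_start_def
  by (intro add_right_mono nat_mono ceiling_mono mult_right_mono) auto

lemma block_subset: "\<alpha> \<le> \<gamma> \<Longrightarrow> block \<alpha> \<gamma> n \<subseteq> {block_start \<gamma> n..n ^ 4}"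
  using block_start_antimono[of \<alpha> \<gamma> n] by (auto simp: block_def thin_def)

lemma card_thin:
  assumes n: "n \<ge> 1"
  shows "card (thin g n) \<le> 4 * n ^ 2"
proof -
  define q where "q = n ^ 2"
  define N where "N = n ^ 4"
  have N: "N = q * q" by (simp add: N_def q_def power_add[symmetric])
  have q: "1 \<le> q" using n by (simp add: q_def)
  have T: "thin g n = {x \<in> {g..N}. x < g + q \<or> N < x + q \<or> q dvd x}"
    by (simp add: thin_def q_def N_def)
  have "thin g n \<subseteq> {g..<g + q} \<union> {N - q<..N} \<union> (\<lambda>i. q * i) ` {..q}"
  proof
    fix x assume x: "x \<in> thin g n"
    show "x \<in> {g..<g + q} \<union> {N - q<..N} \<union> (\<lambda>i. q * i) ` {..q}"
    proof (cases "q dvd x")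
      case True
      then obtain i where i: "x = q * i" by (rule dvdE)
      then have "q * i \<le> q * q" using x N by (simp add: T)
      then have "i \<le> q" using q by simp
      then show ?thesis using i by blast
    next
      case False
      moreover have "q \<le> N" using q N by simp
      ultimately show ?thesis using x by (auto simp: T)
    qed
  qed
  then have "card (thin g n) \<le> card ({g..<g + q} \<union> {N - q<..N} \<union> (\<lambda>i. q * i) ` {..q})"
    by (intro card_mono) auto
  moreover have "card ({g..<g + q} \<union> {N - q<..N} \<union> (\<lambda>i. q * i) ` {..q})
    \<le> card ({g..<g + q} \<union> {N - q<..N}) + card ((\<lambda>i. q * i) ` {..q})"
    by (rule card_Un_le)
  moreover have "card ({g..<g + q} \<union> {N - q<..N}) \<le> card {g..<g + q} + card {N - q<..N}"
    by (rule card_Un_le)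
  moreover have "card ((\<lambda>i. q * i) ` {..q}) \<le> Suc q"
    using card_image_le[of "{..q}" "\<lambda>i. q * i"] by simp
  moreover have "card {g..<g + q} = q" "card {N - q<..N} \<le> q" by simp_all
  ultimately have "card (thin g n) \<le> 4 * q" using q by linarith
  then show ?thesis by (simp add: q_def)
qed

text \<open>Below \<open>g + N\<close> a summand near \<open>g\<close> fixes the residue modulo
  \<open>n ^ 2\<close>, above it a summand near \<open>N\<close>. The margin \<open>n ^ 2\<close> at
  each end keeps the other summand, a multiple of \<open>n ^ 2\<close>, inside
  \<open>[g, N]\<close>.\<close>

lemma thin_sumset:
  assumes n: "n \<ge> 1"
  shows "{2 * g + n ^ 2..2 * n ^ 4 - n ^ 2} \<subseteq> thin g n + thin g n"
proof
  fix y assume y: "y \<in> {2 * g + n ^ 2..2 * n ^ 4 - n ^ 2}"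
  define q where "q = n ^ 2"
  define N where "N = n ^ 4"
  have q: "1 \<le> q" using n by (simp add: q_def)
  have y': "2 * g + q \<le> y" "y + q \<le> 2 * N"
    using y q unfolding q_def N_def by auto
  have T: "thin g n = {x \<in> {g..N}. x < g + q \<or> N < x + q \<or> q dvd x}"
    by (simp add: thin_def q_def N_def)
  show "y \<in> thin g n + thin g n"
  proof (cases "y \<le> g + N")
    case True
    define i where "i = (y - g) mod q"
    have i: "i < q" "i \<le> y - g" using q by (auto simp: i_def)
    have "g + i \<in> thin g n" using i y' by (auto simp: T)
    moreover have "q dvd y - g - i" unfolding i_def by (rule dvd_minus_mod)
    then have "y - g - i \<in> thin g n"
      using i y' True by (auto simp: T)
    moreover have "g + i + (y - g - i) = y" using i y' by simp
    ultimately show ?thesis by (metis set_plus_intro)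
  next
    case False
    define i where "i = (q - (y - N) mod q) mod q"
    have i: "i < q" using q by (simp add: i_def)
    have "q dvd (y - N) + i"
    proof -
      have "((y - N) + i) mod q = ((y - N) mod q + (q - (y - N) mod q)) mod q"
        unfolding i_def by (simp add: mod_add_right_eq mod_add_left_eq)
      also have "(y - N) mod q + (q - (y - N) mod q) = q"
        using q mod_less_divisor[of q "y - N"] by simp
      finally show ?thesis by (simp add: dvd_eq_mod_eq_0)
    qed
    then have "y - N + i \<in> thin g n" using i y' False by (auto simp: T)
    moreover have "N - i \<in> thin g n" using i y' by (auto simp: T)
    moreover have "N - i + (y - N + i) = y" using i y' False by simp
    ultimately show ?thesis by (metis set_plus_intro)
  qed
qed

section \<open>Counting at a single scale\<close>

lemma card_bounded_below:
  assumes "\<And>y. y \<in> S \<Longrightarrow> a \<le> real y \<and> y \<le> x"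
  shows "real (card S) \<le> max 0 (real x - a) + 1"
proof -
  have "S \<subseteq> {nat \<lceil>a\<rceil>..x}" using assms by (auto simp: nat_le_iff ceiling_le_iff)
  then have "card S \<le> card {nat \<lceil>a\<rceil>..x}" by (intro card_mono) auto
  also have "\<dots> = Suc x - nat \<lceil>a\<rceil>" by simp
  finally have "real (card S) \<le> max 0 (real (Suc x) - real (nat \<lceil>a\<rceil>))" by linarith
  moreover have "a \<le> real (nat \<lceil>a\<rceil>)" by linarith
  ultimately show ?thesis by linarith
qed

lemma lacunary_below:
  assumes "x \<in> lacunary \<alpha> \<gamma>" "x < scale (Suc (Suc j)) ^ 3"
  shows "x \<le> scale j ^ 4 \<or> x \<in> block \<alpha> \<gamma> (scale (Suc j))"
proof (cases "x \<le> 1")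
  case True
  then show ?thesis using two_le_scale[of j] one_le_power[of "scale j" 4] by linarith
next
  case False
  then obtain i where i: "x \<in> block \<alpha> \<gamma> (scale i)"
    using assms(1) by (auto simp: lacunary_def)
  have "scale i ^ 3 \<le> x" "x \<le> scale i ^ 4"
    using i cube_le_block_start[of "scale i" \<alpha>] cube_le_block_start[of "scale i" \<gamma>]
    by (auto simp: block_def thin_def)
  then consider "i \<le> j" | "i = Suc j" | "Suc (Suc j) \<le> i" by linarith
  then show ?thesis
  proof cases
    case 1
    then have "scale i ^ 4 \<le> scale j ^ 4" using monoD[OF mono_scale] by (intro power_mono) auto
    then show ?thesis using \<open>x \<le> scale i ^ 4\<close> by linarith
  next
    case 2
    then show ?thesis using i by simp
  next
    case 3
    then have "scale (Suc (Suc j)) ^ 3 \<le> scale i ^ 3"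
      using monoD[OF mono_scale] by (intro power_mono) auto
    then show ?thesis using \<open>scale i ^ 3 \<le> x\<close> assms(2) by linarith
  qed
qed

lemma lacunary_below_le:
  assumes "x \<in> lacunary \<alpha> \<gamma>" "x < scale (Suc (Suc j)) ^ 3"
  shows "x \<le> scale (Suc j) ^ 4"
proof -
  have "scale j ^ 4 \<le> scale (Suc j) ^ 4" using monoD[OF mono_scale] by (intro power_mono) auto
  moreover have "y \<le> scale (Suc j) ^ 4" if "y \<in> block \<alpha> \<gamma> (scale (Suc j))" for y
    using that by (auto simp: block_def thin_def)
  ultimately show ?thesis using lacunary_below[OF assms] order_trans by blast
qed

lemma twice_scale_less: "2 * scale (Suc j) ^ 4 < scale (Suc (Suc j)) ^ 3"
proof -
  let ?n = "scale (Suc j)"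
  have n: "2 \<le> ?n" by (rule two_le_scale)
  have "2 * ?n ^ 4 \<le> ?n * ?n ^ 4" using n by (intro mult_right_mono) auto
  also have "\<dots> = ?n ^ 5" by (simp add: power_Suc[symmetric])
  also have "\<dots> < ?n ^ 15" using n by (intro power_strict_increasing) auto
  also have "\<dots> = scale (Suc (Suc j)) ^ 3" by (simp add: scale_Suc[of "Suc j"] power_mult[symmetric])
  finally show ?thesis .
qed

lemma block_subset_lacunary: "block \<alpha> \<gamma> (scale j) \<subseteq> lacunary \<alpha> \<gamma>"
  by (auto simp: lacunary_def)

lemma upper_density_lacunary:
  assumes \<alpha>: "0 \<le> \<alpha>" "\<alpha> \<le> 1"
  shows "upper_density (lacunary \<alpha> \<gamma>) = \<alpha>"
proof (rule antisym)
  let ?A = "lacunary \<alpha> \<gamma>"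
  show "upper_density ?A \<le> \<alpha>"
  \<comment> \<open>The constant \<open>6\<close> counts multiples of \<open>n ^ 2\<close>: one for
    the earlier scales, four for the thin set, one for rounding. The window starts at
    \<open>n ^ 3\<close>, so \<open>n ^ 2\<close> is at most \<open>x / Suc j\<close>.\<close>
  proof (rule upper_density_le_blocks[where p = "\<lambda>j. scale (Suc j) ^ 3" and P = "\<lambda>j. scale (Suc j) ^ 4" and C = 6])
    show "0 \<le> \<alpha>" by fact
    show "mono (\<lambda>j. scale (Suc j) ^ 3)"
      using mono_scale by (auto simp: mono_def intro!: power_mono)
    fix j
    define n where "n = scale (Suc j)"
    define m where "m = scale j"
    have nm: "n = m ^ 5" by (simp add: n_def m_def scale_Suc)
    have m: "1 \<le> m" "Suc j \<le> m" using two_le_scale[of j] Suc_le_scale[of j] by (auto simp: m_def)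
    have n: "1 \<le> n" "Suc j \<le> n" using two_le_scale[of "Suc j"] Suc_le_scale[of "Suc j"] by (auto simp: n_def)
    show "j \<le> scale (Suc j) ^ 3" "scale (Suc j) ^ 3 \<le> scale (Suc j) ^ 4"
      using n self_le_power[of n 3] by (auto simp: n_def[symmetric] intro: power_increasing)
    show "?A \<inter> {scale (Suc j) ^ 4<..<scale (Suc (Suc j)) ^ 3} = {}"
      using lacunary_below_le[of _ \<alpha> \<gamma> j] by fastforce
    fix x assume "scale (Suc j) ^ 3 \<le> x" "x \<le> scale (Suc j) ^ 4"
    then have x: "n ^ 3 \<le> x" "x \<le> n ^ 4" by (simp_all add: n_def)
    define l where "l = block_start \<alpha> n"
    define T where "T = thin (block_start \<gamma> n) n"
    define H where "H = {y. l \<le> y \<and> y \<le> x}"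
    have "x < scale (Suc (Suc j)) ^ 3" using x(2) twice_scale_less[of j] by (simp add: n_def)
    then have "y \<in> {1..m ^ 4} \<union> T \<union> H" if "y \<in> ?A \<inter> {1..x}" for y
      using lacunary_below[of y \<alpha> \<gamma> j] that
      by (auto simp: m_def n_def[symmetric] block_def T_def H_def l_def)
    then have sub: "?A \<inter> {1..x} \<subseteq> {1..m ^ 4} \<union> T \<union> H" by blast
    have fin: "finite T" "finite H" by (auto simp: T_def thin_def H_def)
    have "card (?A \<inter> {1..x}) \<le> card ({1..m ^ 4} \<union> T \<union> H)"
      using sub fin by (intro card_mono) auto
    also have "\<dots> \<le> card ({1..m ^ 4} \<union> T) + card H" by (rule card_Un_le)
    also have "\<dots> \<le> m ^ 4 + card T + card H" using card_Un_le[of "{1..m ^ 4}" T] by simp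
    finally have "card (?A \<inter> {1..x}) \<le> m ^ 4 + 4 * n ^ 2 + card H"
      using card_thin[OF n(1), of "block_start \<gamma> n"] by (simp add: T_def)
    moreover have "m ^ 4 \<le> n ^ 2" "1 \<le> n ^ 2"
      using m n(1) by (simp_all add: nm power_mult[symmetric] power_increasing)
    ultimately have "card (?A \<inter> {1..x}) + 1 \<le> 6 * n ^ 2 + card H" by linarith
    then have 1: "real (card (?A \<inter> {1..x})) + 1 \<le> 6 * real (n ^ 2) + real (card H)" by linarith
    have "real (card H) \<le> max 0 (real x - (1 - \<alpha>) * real (n ^ 4)) + 1"
    proof (rule card_bounded_below)
      fix y assume "y \<in> H"
      then have "real l \<le> real y" "y \<le> x" by (auto simp: H_def)
      then show "(1 - \<alpha>) * real (n ^ 4) \<le> real y \<and> y \<le> x"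
        using block_start_bounds(1)[OF \<alpha>(2), of n] of_nat_0_le_iff[of "n ^ 3", where 'a = real] unfolding l_def by linarith
    qed
    moreover have "real x \<le> real (n ^ 4)" using x(2) by (simp only: of_nat_le_iff)
    then have "(1 - \<alpha>) * real x \<le> (1 - \<alpha>) * real (n ^ 4)"
      using \<alpha>(2) by (intro mult_left_mono) auto
    then have "real x - (1 - \<alpha>) * real (n ^ 4) \<le> \<alpha> * real x" by (simp add: algebra_simps)
    moreover have "0 \<le> \<alpha> * real x" using \<alpha>(1) by simp
    ultimately have 2: "real (card H) \<le> \<alpha> * real x + 1" by linarith
    have "n ^ 2 * Suc j \<le> n ^ 2 * n" using n(2) by (rule mult_left_mono) simp
    also have "\<dots> = n ^ 3" by (simp add: power3_eq_cube power2_eq_square)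
    finally have "n ^ 2 * Suc j \<le> x" using x(1) by linarith
    then have "real (n ^ 2) * real (Suc j) \<le> real x" by (metis of_nat_le_iff of_nat_mult)
    then have "real (n ^ 2) \<le> real x / real (Suc j)" by (simp add: le_divide_eq)
    then show "real (card (?A \<inter> {1..x})) \<le> (\<alpha> + 6 / real (Suc j)) * real x"
      using 1 2 by (simp add: distrib_right)
  qed
  show "\<alpha> \<le> upper_density ?A"
  proof (rule upper_density_ge_blocks[where p = "\<lambda>j. scale j ^ 4" and C = 1])
    fix j
    define n where "n = scale j"
    have n: "1 \<le> n" "Suc j \<le> n" using two_le_scale[of j] Suc_le_scale[of j] by (auto simp: n_def)
    show "j \<le> scale j ^ 4" using n self_le_power[of n 4] by (auto simp: n_def)
    have "1 \<le> block_start \<alpha> n"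
      using cube_le_block_start[of n \<alpha>] one_le_power[OF n(1), of 3] by linarith
    then have "{block_start \<alpha> n..n ^ 4} \<subseteq> ?A \<inter> {1..n ^ 4}"
      using block_subset_lacunary[of \<alpha> \<gamma> j] by (auto simp: block_def n_def)
    then have "card {block_start \<alpha> n..n ^ 4} \<le> card (?A \<inter> {1..n ^ 4})" by (intro card_mono) auto
    then have "Suc (n ^ 4) - block_start \<alpha> n \<le> card (?A \<inter> {1..n ^ 4})" by simp
    then have "real (n ^ 4) + 1 - real (block_start \<alpha> n) \<le> real (card (?A \<inter> {1..n ^ 4}))" by linarith
    then have 1: "\<alpha> * real (n ^ 4) - real (n ^ 3) \<le> real (card (?A \<inter> {1..n ^ 4}))"
      using block_start_bounds(2)[OF \<alpha>(2), of n] by (simp add: algebra_simps)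
    have "n ^ 3 * Suc j \<le> n ^ 3 * n" using n(2) by (rule mult_left_mono) simp
    also have "\<dots> = n ^ 4" by (simp add: power_Suc2[symmetric])
    finally have "real (n ^ 3) * real (Suc j) \<le> real (n ^ 4)" by (metis of_nat_le_iff of_nat_mult)
    then have "real (n ^ 3) \<le> real (n ^ 4) / real (Suc j)" by (simp add: le_divide_eq)
    then show "(\<alpha> - 1 / real (Suc j)) * real (scale j ^ 4) \<le> real (card (?A \<inter> {1..scale j ^ 4}))"
      using 1 by (simp add: n_def left_diff_distrib)
  qed
qed

text \<open>Apart from negligible sets, \<open>A + A\<close> consists at scale \<open>N = n ^ 4\<close> of the intervals
  \<open>[(1 - \<alpha>) N, N]\<close> and \<open>[2 (1 - \<gamma>) N, 2 N]\<close>. They are disjoint in the first case below,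
  and the second one contains the first in the other case.\<close>

lemma two_intervals_count:
  fixes \<alpha> \<beta> \<gamma> :: real
  assumes \<alpha>: "0 \<le> \<alpha>" "\<alpha> \<le> \<gamma>" and \<beta>: "\<beta> \<le> 1"
    and \<gamma>: "\<gamma> \<le> 1 / 2 \<and> \<beta> = \<gamma> + \<alpha> / 2 \<or> \<gamma> = \<beta> \<and> (1 + \<alpha>) / 2 \<le> \<beta>"
    and x: "x \<le> 2 * N"
  shows "real (card {y. y \<le> x \<and> ((1 - \<alpha>) * real N \<le> real y \<and> y \<le> N \<or> 2 * (1 - \<gamma>) * real N \<le> real y)})
    \<le> \<beta> * real x + 2"
proof -
  define U where "U = {y. y \<le> min x N \<and> (1 - \<alpha>) * real N \<le> real y}"
  define V where "V = {y. y \<le> x \<and> 2 * (1 - \<gamma>) * real N \<le> real y}"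
  have eq: "{y. y \<le> x \<and> ((1 - \<alpha>) * real N \<le> real y \<and> y \<le> N \<or> 2 * (1 - \<gamma>) * real N \<le> real y)} = U \<union> V"
    by (auto simp: U_def V_def)
  have U: "real (card U) \<le> max 0 (real (min x N) - (1 - \<alpha>) * real N) + 1"
    by (rule card_bounded_below) (auto simp: U_def)
  have V: "real (card V) \<le> max 0 (real x - 2 * (1 - \<gamma>) * real N) + 1"
    by (rule card_bounded_below) (auto simp: V_def)
  \<comment> \<open>This reduces the estimate to the right end \<open>x = 2 * N\<close>, where an
    interval ending there is relatively largest.\<close>
  have xN: "(1 - \<beta>) * real x \<le> (1 - \<beta>) * (2 * real N)" using x \<beta> by (intro mult_left_mono) auto
  show ?thesis
  proof (cases "\<gamma> = \<beta> \<and> (1 + \<alpha>) / 2 \<le> \<beta>")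
    case True
    have "2 * (1 - \<gamma>) * real N \<le> (1 - \<alpha>) * real N" using True by (intro mult_right_mono) auto
    then have "U \<subseteq> V" by (auto simp: U_def V_def)
    then have "U \<union> V = V" by blast
    moreover have "real x - 2 * (1 - \<gamma>) * real N \<le> \<beta> * real x" using xN True by (simp add: algebra_simps)
    moreover have "0 \<le> \<beta> * real x" using True \<alpha> by simp
    ultimately show ?thesis unfolding eq using V by simp
  next
    case False
    then have c: "\<gamma> \<le> 1 / 2" "\<beta> = \<gamma> + \<alpha> / 2" using \<gamma> by blast+
    have "card (U \<union> V) \<le> card U + card V" by (rule card_Un_le)
    then have UV: "real (card (U \<union> V)) \<le> real (card U) + real (card V)" by linarith
    have "real N \<le> 2 * (1 - \<gamma>) * real N" using c mult_right_mono[of 1 "2 * (1 - \<gamma>)" "real N"] by simp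
    have pos: "0 \<le> \<beta> * real x" using \<alpha> c by simp
    \<comment> \<open>Relative to \<open>x\<close> the count can peak only at \<open>N\<close> and
      at \<open>2 * N\<close>. The first peak is \<alpha>, which is at most \<beta> because
      \<open>\<alpha> \<le> \<gamma>\<close>.\<close>
    have "max 0 (real (min x N) - (1 - \<alpha>) * real N) + max 0 (real x - 2 * (1 - \<gamma>) * real N) \<le> \<beta> * real x"
    proof (cases "real x \<le> 2 * (1 - \<gamma>) * real N")
      case True
      have "(1 - \<alpha>) * real (min x N) \<le> (1 - \<alpha>) * real N" using \<alpha> c by (intro mult_left_mono) auto
      moreover have "\<alpha> * real (min x N) \<le> \<beta> * real x" using \<alpha> c by (intro mult_mono) auto
      ultimately have "real (min x N) - (1 - \<alpha>) * real N \<le> \<beta> * real x" by (simp add: algebra_simps)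
      then show ?thesis using True pos by simp
    next
      case False
      then have "min x N = N" using \<open>real N \<le> 2 * (1 - \<gamma>) * real N\<close> by simp
      moreover have "0 \<le> \<alpha> * real N" using \<alpha> by simp
      ultimately have "max 0 (real (min x N) - (1 - \<alpha>) * real N) = \<alpha> * real N"
        by (simp add: algebra_simps)
      moreover have "\<alpha> * real N + (real x - 2 * (1 - \<gamma>) * real N) \<le> \<beta> * real x"
        using xN unfolding c(2) by (simp add: algebra_simps)
      ultimately show ?thesis using False by simp
    qed
    then show ?thesis unfolding eq using U V UV by linarith
  qed
qed

lemma upper_density_sumset_lacunary:
  assumes \<alpha>: "0 \<le> \<alpha>" "\<alpha> \<le> \<gamma>" "\<gamma> \<le> 1" and \<beta>: "0 \<le> \<beta>" "\<beta> \<le> 1"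
    and \<gamma>: "\<gamma> \<le> 1 / 2 \<and> \<beta> = \<gamma> + \<alpha> / 2 \<or> \<gamma> = \<beta> \<and> (1 + \<alpha>) / 2 \<le> \<beta>"
  shows "upper_density (lacunary \<alpha> \<gamma> + lacunary \<alpha> \<gamma>) = \<beta>"
proof (rule antisym)
  let ?A = "lacunary \<alpha> \<gamma>"
  have \<alpha>1: "\<alpha> \<le> 1" using \<alpha> by simp
  show "upper_density (?A + ?A) \<le> \<beta>"
  proof (rule upper_density_le_blocks[where p = "\<lambda>j. scale (Suc j) ^ 3" and P = "\<lambda>j. 2 * scale (Suc j) ^ 4" and C = 14])
    show "0 \<le> \<beta>" by fact
    show "mono (\<lambda>j. scale (Suc j) ^ 3)"
      using mono_scale by (auto simp: mono_def intro!: power_mono)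
    fix j
    define n where "n = scale (Suc j)"
    define m where "m = scale j"
    have nm: "n = m ^ 5" by (simp add: n_def m_def scale_Suc)
    have m: "1 \<le> m" "Suc j \<le> m" using two_le_scale[of j] Suc_le_scale[of j] by (auto simp: m_def)
    have n: "1 \<le> n" "Suc j \<le> n" using two_le_scale[of "Suc j"] Suc_le_scale[of "Suc j"] by (auto simp: n_def)
    show "j \<le> scale (Suc j) ^ 3" using n self_le_power[of n 3] by (auto simp: n_def[symmetric])
    have "n ^ 3 \<le> n ^ 4" using n by (intro power_increasing) auto
    then show "scale (Suc j) ^ 3 \<le> 2 * scale (Suc j) ^ 4" by (simp add: n_def)
    show "(?A + ?A) \<inter> {2 * scale (Suc j) ^ 4<..<scale (Suc (Suc j)) ^ 3} = {}"
    proof -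
      have False if "z \<in> ?A + ?A" "2 * scale (Suc j) ^ 4 < z" "z < scale (Suc (Suc j)) ^ 3" for z
      proof -
        from that(1) obtain a b where ab: "a \<in> ?A" "b \<in> ?A" "z = a + b" by (auto elim!: set_plus_elim)
        then have "a \<le> scale (Suc j) ^ 4" "b \<le> scale (Suc j) ^ 4"
          using lacunary_below_le that(3) by auto
        then show False using that(2) ab(3) by linarith
      qed
      then show ?thesis by auto
    qed
    fix x assume "scale (Suc j) ^ 3 \<le> x" "x \<le> 2 * scale (Suc j) ^ 4"
    then have x: "n ^ 3 \<le> x" "x \<le> 2 * n ^ 4" by (simp_all add: n_def)
    define N where "N = n ^ 4"
    define M where "M = m ^ 4"
    define l where "l = block_start \<alpha> n"
    define g where "g = block_start \<gamma> n"
    define T where "T = thin g n"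
    define H where "H = {y. y \<le> x \<and> ((1 - \<alpha>) * real N \<le> real y \<and> y \<le> N \<or> 2 * (1 - \<gamma>) * real N \<le> real y)}"
    have l: "(1 - \<alpha>) * real N \<le> real l"
      using block_start_bounds(1)[OF \<alpha>1, of n] of_nat_0_le_iff[of "n ^ 3", where 'a = real]
      unfolding l_def N_def by linarith
    have g: "(1 - \<gamma>) * real N \<le> real g"
      using block_start_bounds(1)[OF \<alpha>(3), of n] of_nat_0_le_iff[of "n ^ 3", where 'a = real]
      unfolding g_def N_def by linarith
    have xs: "x < scale (Suc (Suc j)) ^ 3" using x(2) twice_scale_less[of j] by (simp add: n_def)
    have split: "a \<le> M \<or> a \<in> T \<or> l \<le> a \<and> a \<le> N" "a \<le> M \<or> g \<le> a \<and> a \<le> N" if "a \<in> ?A" "a \<le> x" for a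
    proof -
      have "a \<le> M \<or> a \<in> block \<alpha> \<gamma> n"
        using lacunary_below[OF that(1), of j] that(2) xs by (simp add: n_def M_def m_def)
      then show "a \<le> M \<or> a \<in> T \<or> l \<le> a \<and> a \<le> N" "a \<le> M \<or> g \<le> a \<and> a \<le> N"
        using block_subset[OF \<alpha>(2), of n] by (auto simp: block_def T_def l_def g_def N_def)
    qed
    have mixed: "a + b \<in> (T + {..M}) \<union> {N..N + M} \<union> H"
      if "a \<in> T \<or> l \<le> a \<and> a \<le> N" "b \<le> M" "a + b \<le> x" for a b
    proof (cases "a \<in> T")
      case True
      then have "a + b \<in> T + {..M}" using that(2) by (intro set_plus_intro) auto
      then show ?thesis by blast
    next
      case False
      then have a: "l \<le> a" "a \<le> N" using that(1) by blast+
      then have "(1 - \<alpha>) * real N \<le> real (a + b)" using l by simp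
      then show ?thesis using a that(2,3) by (auto simp: H_def)
    qed
    \<comment> \<open>Summands up to \<open>M\<close> come from earlier scales, the others from the
      current block. Two large ones give at least \<open>2 * g\<close>; a small one moves an
      interval element at most \<open>M\<close> past \<open>N\<close>, and thin elements are too few
      to matter.\<close>
    have "(?A + ?A) \<inter> {1..x} \<subseteq> {1..2 * M} \<union> (T + {..M}) \<union> {N..N + M} \<union> H"
    proof
      fix z assume z: "z \<in> (?A + ?A) \<inter> {1..x}"
      then obtain a b where ab: "a \<in> ?A" "b \<in> ?A" "z = a + b" by (auto elim!: set_plus_elim)
      have le: "a \<le> x" "b \<le> x" using z ab(3) by auto
      consider "a \<le> M" "b \<le> M" | "a \<le> M" "\<not> b \<le> M" | "\<not> a \<le> M" "b \<le> M" | "\<not> a \<le> M" "\<not> b \<le> M"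
        by blast
      then show "z \<in> {1..2 * M} \<union> (T + {..M}) \<union> {N..N + M} \<union> H"
      proof cases
        case 1
        then show ?thesis using z ab(3) by auto
      next
        case 2
        then show ?thesis using mixed[of b a] split(1)[OF ab(2) le(2)] z ab(3) by (auto simp: add.commute)
      next
        case 3
        then show ?thesis using mixed[of a b] split(1)[OF ab(1) le(1)] z ab(3) by auto
      next
        case 4
        then have "g \<le> a" "g \<le> b" using split(2)[OF ab(1) le(1)] split(2)[OF ab(2) le(2)] by blast+
        then have "real g + real g \<le> real z" using ab(3) by simp
        moreover have "2 * (1 - \<gamma>) * real N = (1 - \<gamma>) * real N + (1 - \<gamma>) * real N"
          by (simp add: algebra_simps)
        ultimately have "2 * (1 - \<gamma>) * real N \<le> real z" using g by linarith
        then show ?thesis using z by (simp add: H_def)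
      qed
    qed
    moreover have fin: "finite T" "finite (T + {..M})" "finite H"
      by (auto simp: T_def thin_def H_def intro!: finite_set_plus)
    ultimately have "card ((?A + ?A) \<inter> {1..x}) \<le> card ({1..2 * M} \<union> (T + {..M}) \<union> {N..N + M} \<union> H)"
      by (intro card_mono) auto
    moreover have "card ({1..2 * M} \<union> (T + {..M}) \<union> {N..N + M} \<union> H)
      \<le> card ({1..2 * M} \<union> (T + {..M}) \<union> {N..N + M}) + card H" by (rule card_Un_le)
    moreover have "card ({1..2 * M} \<union> (T + {..M}) \<union> {N..N + M})
      \<le> card ({1..2 * M} \<union> (T + {..M})) + card {N..N + M}" by (rule card_Un_le)
    moreover have "card ({1..2 * M} \<union> (T + {..M})) \<le> card {1..2 * M} + card (T + {..M})"
      by (rule card_Un_le)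
    moreover have "card {1..2 * M} = 2 * M" "card {N..N + M} = M + 1" by simp_all
    moreover have "card (T + {..M}) \<le> 4 * n ^ 2 * (M + 1)"
    proof -
      have "card (T + {..M}) \<le> card (T \<times> {..M})"
        unfolding set_plus_image using fin(1) by (intro card_image_le) auto
      also have "\<dots> = card T * (M + 1)" by (simp add: card_cartesian_product)
      also have "\<dots> \<le> 4 * n ^ 2 * (M + 1)"
        unfolding T_def by (intro mult_right_mono card_thin[OF n(1)]) simp
      finally show ?thesis .
    qed
    ultimately have "card ((?A + ?A) \<inter> {1..x}) + 2
      \<le> 2 * M + 4 * n ^ 2 * (M + 1) + (M + 1) + 2 + card H" by linarith
    define E where "E = 2 * M + 4 * n ^ 2 * (M + 1) + (M + 1) + 2"
    have 1: "real (card ((?A + ?A) \<inter> {1..x})) + 2 \<le> real E + real (card H)"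
      using \<open>card ((?A + ?A) \<inter> {1..x}) + 2 \<le> _\<close> unfolding E_def[symmetric] by linarith
    have 2: "real (card H) \<le> \<beta> * real x + 2"
      unfolding H_def using x(2) by (intro two_intervals_count[OF \<alpha>(1,2) \<beta>(2) \<gamma>]) (simp add: N_def)
    \<comment> \<open>The gain of \<open>m \<ge> Suc j\<close> comes from \<open>M * m = n\<close>.
      After multiplication the coefficients are \<open>2 + 4 + 4 + 1 + 3 = 14\<close>, each term at
      most \<open>n ^ 3\<close>.\<close>
    have "E * Suc j \<le> E * m" using m(2) by (rule mult_left_mono) simp
    also have "\<dots> \<le> 14 * n ^ 3"
    proof -
      have Mm: "M * m = n" by (simp add: M_def nm power_Suc2[symmetric])
      have mn: "m \<le> n" using m(1) by (simp add: nm self_le_power)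
      have "n ^ 2 * m \<le> n ^ 2 * n" using mn by (rule mult_left_mono) simp
      then have n2m: "n ^ 2 * m \<le> n ^ 3" by (simp add: power3_eq_cube power2_eq_square)
      have nn: "n \<le> n ^ 3" using n(1) by (simp add: self_le_power)
      have "E * m = 2 * (M * m) + 4 * (n ^ 2 * (M * m)) + 4 * (n ^ 2 * m) + M * m + m + 2 * m"
        by (simp add: E_def algebra_simps)
      also have "\<dots> = 2 * n + 4 * n ^ 3 + 4 * (n ^ 2 * m) + n + m + 2 * m"
        unfolding Mm by (simp add: power3_eq_cube power2_eq_square)
      also have "\<dots> \<le> 14 * n ^ 3" using n2m nn mn by linarith
      finally show ?thesis .
    qed
    finally have "E * Suc j \<le> 14 * x" using x(1) by linarith
    then have "real E * real (Suc j) \<le> 14 * real x"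
      by (metis of_nat_le_iff of_nat_mult of_nat_numeral)
    then have "real E \<le> 14 * real x / real (Suc j)" by (simp add: le_divide_eq)
    then show "real (card ((?A + ?A) \<inter> {1..x})) \<le> (\<beta> + 14 / real (Suc j)) * real x"
      using 1 2 by (simp add: distrib_right)
  qed
  show "\<beta> \<le> upper_density (?A + ?A)"
  proof (rule upper_density_ge_blocks[where p = "\<lambda>j. 2 * scale j ^ 4" and C = 4])
    fix j
    define n where "n = scale j"
    have n: "1 \<le> n" "Suc j \<le> n" using two_le_scale[of j] Suc_le_scale[of j] by (auto simp: n_def)
    have "n \<le> n ^ 4" using n(1) by (simp add: self_le_power)
    then show "j \<le> 2 * scale j ^ 4" using n(2) by (simp add: n_def)
    define N where "N = n ^ 4"
    define l where "l = block_start \<alpha> n"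
    define g where "g = block_start \<gamma> n"
    have g1: "(1 - \<gamma>) * real N + real (n ^ 3) \<le> real g" and g2: "real g \<le> (1 - \<gamma>) * real N + real (n ^ 3) + 1"
      using block_start_bounds[OF \<alpha>(3), of n] by (simp_all add: g_def N_def)
    have l2: "real l \<le> (1 - \<alpha>) * real N + real (n ^ 3) + 1"
      using block_start_bounds(2)[OF \<alpha>1, of n] by (simp add: l_def N_def)
    have n3: "1 \<le> n ^ 3" "n ^ 2 \<le> n ^ 3" using n(1) by (simp_all add: power_increasing)
    have l1: "1 \<le> l" using cube_le_block_start[of n \<alpha>] n3(1) unfolding l_def by linarith
    have BA: "block \<alpha> \<gamma> n \<subseteq> ?A" using block_subset_lacunary by (simp add: n_def)
    have "0 \<in> ?A" by (simp add: lacunary_def)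
    define I where "I = {l..N}"
    define K where "K = {2 * g + n ^ 2..2 * N - n ^ 2}"
    have I: "I \<subseteq> (?A + ?A) \<inter> {1..2 * N}"
    proof
      fix y assume y: "y \<in> I"
      then have "y \<in> ?A" using BA by (auto simp: I_def l_def N_def block_def)
      then have "y + 0 \<in> ?A + ?A" using \<open>0 \<in> ?A\<close> by (rule set_plus_intro)
      then show "y \<in> (?A + ?A) \<inter> {1..2 * N}" using y l1 by (auto simp: I_def)
    qed
    have "thin g n \<subseteq> ?A" using BA by (auto simp: block_def g_def)
    then have "thin g n + thin g n \<subseteq> ?A + ?A" by (intro set_plus_mono2)
    moreover have "K \<subseteq> thin g n + thin g n" using thin_sumset[OF n(1)] by (simp add: K_def N_def)
    moreover have "1 \<le> g" using cube_le_block_start[of n \<gamma>] n3(1) unfolding g_def by linarith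
    then have "K \<subseteq> {1..2 * N}" by (auto simp: K_def)
    ultimately have K: "K \<subseteq> (?A + ?A) \<inter> {1..2 * N}" by blast
    have cI: "\<alpha> * real N - real (n ^ 3) \<le> real (card I)"
    proof -
      have "card I = Suc N - l" by (simp add: I_def)
      then have "real N + 1 - real l \<le> real (card I)" by linarith
      then show ?thesis using l2 by (simp add: algebra_simps)
    qed
    have cK: "2 * \<gamma> * real N - 5 * real (n ^ 3) \<le> real (card K)"
    proof -
      have "card K = Suc (2 * N - n ^ 2) - (2 * g + n ^ 2)" by (simp add: K_def)
      then have "2 * real N + 1 - real (n ^ 2) - 2 * real g - real (n ^ 2) \<le> real (card K)" by linarith
      moreover have "real (n ^ 2) \<le> real (n ^ 3)" "1 \<le> real (n ^ 3)" using n3 by linarith+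
      ultimately show ?thesis using g2 by (simp add: algebra_simps)
    qed
    \<comment> \<open>The losses in \<open>cI\<close> and \<open>cK\<close> total
      \<open>6 * n ^ 3\<close>; rounding up to \<open>8\<close> matches \<open>C = 4\<close> at
      length \<open>2 * N\<close>.\<close>
    have "2 * \<beta> * real N - 8 * real (n ^ 3) \<le> real (card ((?A + ?A) \<inter> {1..2 * N}))"
    proof (cases "\<gamma> = \<beta> \<and> (1 + \<alpha>) / 2 \<le> \<beta>")
      case True
      have "card K \<le> card ((?A + ?A) \<inter> {1..2 * N})" using K by (intro card_mono) auto
      then have "real (card K) \<le> real (card ((?A + ?A) \<inter> {1..2 * N}))" by linarith
      moreover have "2 * \<gamma> * real N = 2 * \<beta> * real N" using True by simp
      ultimately show ?thesis using cK of_nat_0_le_iff[of "n ^ 3", where 'a = real] by linarith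
    next
      case False
      then have c: "\<gamma> \<le> 1 / 2" "\<beta> = \<gamma> + \<alpha> / 2" using \<gamma> by blast+
      have "real N \<le> 2 * (1 - \<gamma>) * real N" using c mult_right_mono[of 1 "2 * (1 - \<gamma>)" "real N"] by simp
      \<comment> \<open>The shift by \<open>n ^ 3\<close> makes this strict even at
        \<open>\<gamma> = 1 / 2\<close>.\<close>
      then have "real N < 2 * real g" using g1 n3(1) by linarith
      then have "N < 2 * g" by linarith
      then have "I \<inter> K = {}" by (auto simp: I_def K_def)
      then have "card (I \<union> K) = card I + card K"
        by (intro card_Un_disjoint) (auto simp: I_def K_def)
      moreover have "card (I \<union> K) \<le> card ((?A + ?A) \<inter> {1..2 * N})" using I K by (intro card_mono) auto
      ultimately have "real (card I) + real (card K) \<le> real (card ((?A + ?A) \<inter> {1..2 * N}))" by linarith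
      moreover have "2 * \<beta> * real N = \<alpha> * real N + 2 * \<gamma> * real N" by (simp add: c algebra_simps)
      ultimately show ?thesis using cI cK of_nat_0_le_iff[of "n ^ 3", where 'a = real] by linarith
    qed
    moreover have "n ^ 3 * Suc j \<le> n ^ 3 * n" using n(2) by (rule mult_left_mono) simp
    then have "n ^ 3 * Suc j \<le> N" by (simp add: N_def power_Suc2[symmetric])
    then have "real (n ^ 3) * real (Suc j) \<le> real N" by (metis of_nat_le_iff of_nat_mult)
    then have "real (n ^ 3) \<le> real N / real (Suc j)" by (simp add: le_divide_eq)
    ultimately have "2 * \<beta> * real N - 8 * (real N / real (Suc j)) \<le> real (card ((?A + ?A) \<inter> {1..2 * N}))"
      by linarith
    moreover have "(\<beta> - 4 / real (Suc j)) * real (2 * N) = 2 * \<beta> * real N - 8 * (real N / real (Suc j))"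
      by (simp add: left_diff_distrib)
    ultimately show "(\<beta> - 4 / real (Suc j)) * real (2 * scale j ^ 4) \<le> real (card ((?A + ?A) \<inter> {1..2 * scale j ^ 4}))"
      by (simp add: N_def n_def)
  qed
qed

lemma Gcd_diffset_lacunary: "Gcd (diffset (lacunary \<alpha> \<gamma>)) = 1"
proof -
  have "int 1 - int 0 \<in> diffset (lacunary \<alpha> \<gamma>)"
    unfolding diffset_def lacunary_def by blast
  from Gcd_dvd[OF this] have "Gcd (diffset (lacunary \<alpha> \<gamma>)) dvd 1" by simp
  then show ?thesis by simp
qed

theorem theorem4p1:
  "{(upper_density A, upper_density (A + A)) | A :: nat set. Gcd (diffset A) = 1} = \<U>"
proof (intro equalityI subsetI)
  fix z assume "z \<in> {(upper_density A, upper_density (A + A)) | A :: nat set. Gcd (diffset A) = 1}"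
  then show "z \<in> \<U>"
    using f_min_le_upper_density_sumset upper_density_nonneg upper_density_le_1
    by (auto simp: \<U>_def)
next
  fix z assume "z \<in> \<U>"
  then obtain \<alpha> \<beta> where z: "z = (\<alpha>, \<beta>)" "0 \<le> \<alpha>" "\<alpha> \<le> 1" "0 \<le> \<beta>" "\<beta> \<le> 1" "f_min \<alpha> \<le> \<beta>"
    by (auto simp: \<U>_def)
  \<comment> \<open>Below \<open>(1 + \<alpha>) / 2\<close>, solving
    \<open>\<beta> = \<gamma> + \<alpha> / 2\<close> gives \<open>\<gamma> < 1 / 2\<close>, and
    \<open>\<gamma> \<ge> \<alpha>\<close> because \<open>f_min \<alpha> \<le> \<beta>\<close> then
    means \<open>3 * \<alpha> / 2 \<le> \<beta>\<close>. From \<open>(1 + \<alpha>) / 2\<close> on,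
    the intervals are nested.\<close>
  define \<gamma> where "\<gamma> = (if \<beta> < (1 + \<alpha>) / 2 then \<beta> - \<alpha> / 2 else \<beta>)"
  have \<gamma>: "\<alpha> \<le> \<gamma>" "\<gamma> \<le> 1" "\<gamma> \<le> 1 / 2 \<and> \<beta> = \<gamma> + \<alpha> / 2 \<or> \<gamma> = \<beta> \<and> (1 + \<alpha>) / 2 \<le> \<beta>"
    using z(2-6) by (auto simp: \<gamma>_def f_min_def min_def split: if_splits)
  have "upper_density (lacunary \<alpha> \<gamma>) = \<alpha>" using z by (intro upper_density_lacunary)
  moreover have "upper_density (lacunary \<alpha> \<gamma> + lacunary \<alpha> \<gamma>) = \<beta>"
    using z \<gamma> by (intro upper_density_sumset_lacunary)
  ultimately show "z \<in> {(upper_density A, upper_density (A + A)) | A :: nat set. Gcd (diffset A) = 1}"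
    using z(1) Gcd_diffset_lacunary[of \<alpha> \<gamma>] by (intro CollectI exI[of _ "lacunary \<alpha> \<gamma>"]) simp
qed

end
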